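(* There is an absolute constant $C>0$ such that the following holds. Suppose that $a,N\in\mathbb{N}$ are coprime, and $(\mathbb{Z}/N\mathbb{Z})^*$, the set of non-zero elements of $\mathbb{Z}/N\mathbb{Z}$, is $r$-coloured such that there is no monochromatic solution to $ax_1+x_2-x_3=0$ (in $\mathbb{Z}/N\mathbb{Z}$). Then $N\le \exp((2r)^{C})$.
   Context: An $r$-colouring is a map to $\{1,\dots,r\}$. A monochromatic solution is a triple $(x_1,x_2,x_3)$ of non-zero elements of $\mathbb{Z}/N\mathbb{Z}$, all of the same colour, with $ax_1+x_2-x_3=0$ in $\mathbb{Z}/N\mathbb{Z}$. *)

theory Defs
  imports Complex_Main "HOL-Library.FuncSet" "HOL-Number_Theory.Cong"
begin

text \<open>For \<open>N > 0\<close>, an element of \<open>\<int>/N\<int>\<close> is represented by its least non-negative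
  residue, so its non-zero elements are the integers in \<open>{1..<N}\<close>; equations in
  \<open>\<int>/N\<int>\<close> become congruences modulo \<open>N\<close>.\<close>

definition nonzero_residues :: "nat \<Rightarrow> int set" where
  "nonzero_residues N = {1..<int N}"

definition is_colouring :: "nat \<Rightarrow> 'a set \<Rightarrow> ('a \<Rightarrow> nat) \<Rightarrow> bool" where
  "is_colouring r A c \<longleftrightarrow> c \<in> A \<rightarrow> {1..r}"

text \<open>The three entries need not be distinct.\<close>

definition monochromatic_solution ::
    "nat \<Rightarrow> nat \<Rightarrow> (int \<Rightarrow> nat) \<Rightarrow> int \<Rightarrow> int \<Rightarrow> int \<Rightarrow> bool" where
  "monochromatic_solution a N c x1 x2 x3 \<longleftrightarrow>
     x1 \<in> nonzero_residues N \<and> x2 \<in> nonzero_residues N \<and> x3 \<in> nonzero_residues N \<and>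
     c x1 = c x2 \<and> c x2 = c x3 \<and>
     [int a * x1 + x2 - x3 = 0] (mod int N)"

end

theory Submission
  imports Defs "HOL-Analysis.Analysis"
begin

text \<open>
  For a colour class \<open>A\<close> and a Bohr set \<open>Y\<close> let \<open>M A Y\<close> be the largest density of \<open>A\<close> on a
  translate of \<open>a Y\<close>. Passing to a much smaller Bohr set hardly decreases any \<open>M A Y\<close>, so the sum
  of these quantities over the classes, which is at most \<open>r\<close>, cannot increase by a fixed power of
  \<open>1 / r\<close> more than \<open>poly r\<close> times. On the other hand, take centred Bohr sets \<open>W\<close> and \<open>V\<close>, with \<open>V\<close>
  much smaller than \<open>W\<close> and \<open>W\<close> much smaller than \<open>Y\<close>. Some class \<open>A\<close> has density at least
  \<open>1 / (2 r)\<close> on \<open>W\<close>. If \<open>M A Y\<close> is small, then \<open>M A\<close> jumps on any Bohr set \<open>Z\<close> for which \<open>W\<close> is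
  almost invariant under \<open>a Z\<close>. Otherwise, the absence of solutions \<open>v, v + y \<in> (A - x) / a\<close>,
  \<open>y \<in> A\<close> with \<open>v \<in> V\<close>, \<open>y \<in> W\<close> makes a Fourier coefficient of \<open>(A - x) / a\<close> on \<open>V\<close> large,
  so \<open>M A\<close> increases after one frequency is added. After \<open>poly r\<close> steps the Bohr set has rank
  \<open>poly r\<close> and radius \<open>exp (- poly r)\<close>; hence it degenerates only if \<open>N \<le> exp (poly r)\<close>.
\<close>

section \<open>Periodic functions on the integers, averages and approximate invariance\<close>

locale modulus =
  fixes N :: nat
  assumes N_pos: "N > 0"
begin

text \<open>Sets and functions on the residues modulo \<open>N\<close> are kept as
  \<open>N\<close>-periodic predicates and functions on the integers, so that shifts and dilations
  are ordinary integer arithmetic.\<close>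

definition periodic :: "(int \<Rightarrow> 'b) \<Rightarrow> bool" where
  "periodic F \<longleftrightarrow> (\<forall>x. F (x mod int N) = F x)"

definition reps :: "int set \<Rightarrow> int set" where
  "reps A = A \<inter> {0..<int N}"

definition avg :: "int set \<Rightarrow> (int \<Rightarrow> real) \<Rightarrow> real" where
  "avg B F = (\<Sum>x\<in>reps B. F x) / real (card (reps B))"

text \<open>The points counted form the symmetric difference of \<open>B\<close> and
  \<open>B + t\<close>. This is the only form of regularity of Bohr sets that the density arguments
  use.\<close>

definition almost_invariant :: "real \<Rightarrow> int set \<Rightarrow> int set \<Rightarrow> bool" where
  "almost_invariant \<epsilon> B U \<longleftrightarrow>
     (\<forall>t\<in>U. real (card {x\<in>{0..<int N}. (x - t \<in> B) \<noteq> (x \<in> B)}) \<le> \<epsilon> * real (card (reps B)))"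

text \<open>The inner average is the density on \<open>B\<close> of \<open>(A - x) / a\<close>, the
  preimage of \<open>A\<close> under \<open>b -> x + a b\<close>. The dilation is built in because
  in a solution \<open>x2\<close> and \<open>x3\<close> differ by a multiple of
  \<open>a\<close>.\<close>

definition max_density :: "int set \<Rightarrow> nat \<Rightarrow> int set \<Rightarrow> real" where
  "max_density A a B = (MAX x\<in>{0..<int N}. avg B (\<lambda>b. indicator A (x + int a * b)))"

definition additive_char :: "int \<Rightarrow> complex" where
  "additive_char x = cis (2 * pi * real_of_int x / real N)"

lemma finite_reps [simp]: "finite (reps B)"
  by (simp add: reps_def)

lemma periodic_comp:
  assumes "periodic F"
  shows "periodic (\<lambda>x. F (t + int a * x))" "periodic (\<lambda>x. F (t + x))" "periodic (\<lambda>x. F (x + t))"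
    "periodic (\<lambda>x. F (x - t))" "periodic (\<lambda>x. F (t - x))"
proof -
  have *: "F x = F y" if "x mod int N = y mod int N" for x y
    using assms that unfolding periodic_def by metis
  have "(t + int a * (x mod int N)) mod int N = (t + int a * x) mod int N"
    "(t + x mod int N) mod int N = (t + x) mod int N" "(x mod int N + t) mod int N = (x + t) mod int N"
    "(x mod int N - t) mod int N = (x - t) mod int N" "(t - x mod int N) mod int N = (t - x) mod int N" for x
    by (metis mod_add_right_eq mod_mult_right_eq, simp_all add: mod_simps)
  then show "periodic (\<lambda>x. F (t + int a * x))" "periodic (\<lambda>x. F (t + x))" "periodic (\<lambda>x. F (x + t))"
    "periodic (\<lambda>x. F (x - t))" "periodic (\<lambda>x. F (t - x))"
    unfolding periodic_def by (blast intro: *)+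
qed

lemma periodic_combine:
  "periodic F \<Longrightarrow> periodic G \<Longrightarrow> periodic (\<lambda>x. f (F x) (G x))"
  by (simp add: periodic_def)

lemma periodic_map: "periodic F \<Longrightarrow> periodic (\<lambda>x. f (F x))"
  by (simp add: periodic_def)

lemma periodic_indicator: "periodic (\<lambda>x. x \<in> A) \<Longrightarrow> periodic (\<lambda>x. indicator A x :: 'b::zero_neq_one)"
  by (simp add: periodic_def indicator_def)

lemma sum_shift:
  assumes "periodic F"
  shows "(\<Sum>x\<in>{0..<int N}. F (x + t)) = (\<Sum>x\<in>{0..<int N}. F x)"
proof (rule sum.reindex_bij_witness[where j="\<lambda>x. (x + t) mod int N" and i="\<lambda>x. (x - t) mod int N"])
  fix x assume x: "x \<in> {0..<int N}"
  show "((x + t) mod int N - t) mod int N = x" "((x - t) mod int N + t) mod int N = x"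
    using x by (simp_all add: mod_simps)
  show "(x + t) mod int N \<in> {0..<int N}" "(x - t) mod int N \<in> {0..<int N}"
    using N_pos by simp_all
  show "F ((x + t) mod int N) = F (x + t)"
    using assms by (simp add: periodic_def)
qed

lemma sum_reps_indicator:
  fixes F :: "int \<Rightarrow> 'b::real_normed_vector"
  shows "(\<Sum>x\<in>reps B. F x) = (\<Sum>x\<in>{0..<int N}. indicator B x *\<^sub>R F x)"
  unfolding reps_def by (rule sum.mono_neutral_cong_left) (auto simp: indicator_def)

text \<open>Shifting the argument of \<open>F\<close> amounts to shifting \<open>B\<close>, so only
  points of the symmetric difference contribute, each at most 1.\<close>

lemma sum_translate:
  fixes F :: "int \<Rightarrow> 'b::real_normed_vector"
  assumes inv: "almost_invariant \<epsilon> B U" "t \<in> U" and per: "periodic F" "periodic (\<lambda>x. x \<in> B)"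
    and bd: "\<And>x. norm (F x) \<le> 1"
  shows "norm ((\<Sum>x\<in>reps B. F (x + t)) - (\<Sum>x\<in>reps B. F x)) \<le> \<epsilon> * real (card (reps B))"
proof -
  let ?G = "{0..<int N}"
  let ?D = "{x\<in>?G. (x - t \<in> B) \<noteq> (x \<in> B)}"
  have "(\<Sum>x\<in>reps B. F (x + t)) = (\<Sum>x\<in>?G. indicator B x *\<^sub>R F (x + t))"
    by (rule sum_reps_indicator)
  also have "\<dots> = (\<Sum>x\<in>?G. (\<lambda>y. indicator B (y - t) *\<^sub>R F y) (x + t))"
    by simp
  also have "\<dots> = (\<Sum>x\<in>?G. indicator B (x - t) *\<^sub>R F x)"
    using periodic_combine[OF periodic_comp(4)[OF periodic_indicator[OF per(2)]] per(1), where f="\<lambda>b y. b *\<^sub>R y"]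
    by (intro sum_shift)
  finally have "(\<Sum>x\<in>reps B. F (x + t)) - (\<Sum>x\<in>reps B. F x)
      = (\<Sum>x\<in>?G. (indicator B (x - t) - indicator B x) *\<^sub>R F x)"
    by (simp add: sum_reps_indicator sum_subtractf scaleR_diff_left)
  also have "norm \<dots> \<le> (\<Sum>x\<in>?G. of_bool (x \<in> ?D))"
    by (rule sum_norm_le) (use bd in \<open>auto simp: indicator_def\<close>)
  also have "\<dots> = real (card ?D)"
    by (simp add: Int_def conj_commute)
  also have "\<dots> \<le> \<epsilon> * real (card (reps B))"
    using inv by (auto simp: almost_invariant_def)
  finally show ?thesis .
qed

subsection \<open>Fourier analysis on \<open>\<int>/N\<int>\<close>\<close>

lemma char_add: "additive_char (x + y) = additive_char x * additive_char y"
  by (simp add: additive_char_def cis_mult add_divide_distrib ring_distribs)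

lemma char_diff: "additive_char (x - y) = additive_char x * cnj (additive_char y)"
  by (simp add: additive_char_def cis_cnj cis_mult diff_divide_distrib right_diff_distrib)

lemma norm_char [simp]: "cmod (additive_char x) = 1"
  by (simp add: additive_char_def)

lemma char_multiple: "additive_char (int N * k) = 1"
proof -
  have "2 * pi * real_of_int (int N * k) / real N = 2 * pi * real_of_int k"
    using N_pos by simp
  then show ?thesis
    unfolding additive_char_def by (metis Ints_of_int cis_multiple_2pi)
qed

lemma char_mod: "additive_char (x mod int N) = additive_char x"
proof -
  have "additive_char x = additive_char (x mod int N + int N * (x div int N))"
    by simp
  then show ?thesis
    unfolding char_add by (simp add: char_multiple)
qed

lemma char_mult_mod: "additive_char (\<theta> * (x mod int N)) = additive_char (\<theta> * x)"
  by (metis char_mod mod_mult_right_eq)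

lemma char_power: "additive_char (int k * x) = additive_char x ^ k"
  by (induction k) (simp_all add: distrib_right char_add, simp add: additive_char_def)

lemma char_eq_1: 
  assumes "additive_char x = 1" shows "int N dvd x"
proof -
  have "cos (2 * pi * real_of_int x / real N) = 1"
    using assms by (simp add: additive_char_def complex_eq_iff)
  then obtain k :: int where "2 * pi * real_of_int x / real N = k * 2 * pi"
    by (auto simp: cos_one_2pi_int)
  then have "real_of_int x = real_of_int (k * int N)"
    using N_pos by (simp add: field_simps)
  then have "x = k * int N"
    using of_int_eq_iff by blast
  then show ?thesis by simp
qed

lemma sum_int_interval: "(\<Sum>\<theta>\<in>{0..<int N}. F \<theta>) = (\<Sum>k<N. F (int k))"
  by (rule sum.reindex_bij_witness[where j=nat and i=int]) auto

lemma char_orthogonality: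
  "(\<Sum>\<theta>\<in>{0..<int N}. additive_char (\<theta> * x)) = (if int N dvd x then of_nat N else 0)"
proof (cases "int N dvd x")
  case True
  then have "additive_char (\<theta> * x) = 1" for \<theta>
    by (metis char_multiple dvdE mult.left_commute)
  then show ?thesis using True by simp
next
  case False
  then have "additive_char x \<noteq> 1" using char_eq_1 by blast
  moreover have "additive_char x ^ N = 1"
    using char_multiple[of x] by (simp add: char_power)
  ultimately show ?thesis
    using False by (simp add: sum_int_interval char_power geometric_sum)
qed

lemma eq_if_dvd_diff:
  assumes "x \<in> {0..<int N}" "y \<in> {0..<int N}"
  shows "int N dvd x - y \<longleftrightarrow> x = y"
proof
  assume "int N dvd x - y"
  then have "x mod int N = y mod int N" by (simp add: mod_eq_dvd_iff)
  then show "x = y" using assms by simp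
qed simp

definition fourier :: "(int \<Rightarrow> real) \<Rightarrow> int \<Rightarrow> complex" where
  "fourier f \<theta> = (\<Sum>x\<in>{0..<int N}. of_real (f x) * additive_char (\<theta> * x))"

lemma parseval:
  "(\<Sum>\<theta>\<in>{0..<int N}. (cmod (fourier f \<theta>))\<^sup>2) = real N * (\<Sum>x\<in>{0..<int N}. (f x)\<^sup>2)"
proof -
  let ?G = "{0..<int N}"
  have "complex_of_real (\<Sum>\<theta>\<in>?G. (cmod (fourier f \<theta>))\<^sup>2) = (\<Sum>\<theta>\<in>?G. fourier f \<theta> * cnj (fourier f \<theta>))"
    by (simp only: of_real_sum complex_norm_square)
  also have "\<dots> = (\<Sum>\<theta>\<in>?G. \<Sum>x\<in>?G. \<Sum>y\<in>?G. of_real (f x * f y) * additive_char (\<theta> * (x - y)))"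
    unfolding fourier_def cnj_sum sum_product
    by (intro sum.cong refl) (simp add: right_diff_distrib char_diff)
  also have "\<dots> = (\<Sum>x\<in>?G. \<Sum>y\<in>?G. of_real (f x * f y) * (\<Sum>\<theta>\<in>?G. additive_char (\<theta> * (x - y))))"
  proof -
    have "(\<Sum>\<theta>\<in>?G. \<Sum>x\<in>?G. \<Sum>y\<in>?G. of_real (f x * f y) * additive_char (\<theta> * (x - y)))
      = (\<Sum>x\<in>?G. \<Sum>\<theta>\<in>?G. \<Sum>y\<in>?G. of_real (f x * f y) * additive_char (\<theta> * (x - y)))"
      by (rule sum.swap)
    also have "\<dots> = (\<Sum>x\<in>?G. \<Sum>y\<in>?G. \<Sum>\<theta>\<in>?G. of_real (f x * f y) * additive_char (\<theta> * (x - y)))"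
      by (intro sum.cong refl sum.swap)
    finally show ?thesis by (simp only: sum_distrib_left)
  qed
  also have "\<dots> = (\<Sum>x\<in>?G. \<Sum>y\<in>?G. if x = y then of_real (f x * f y) * of_nat N else 0)"
    by (intro sum.cong refl) (simp add: char_orthogonality eq_if_dvd_diff)
  also have "\<dots> = (\<Sum>x\<in>?G. of_real (f x * f x) * of_nat N)"
    by simp
  also have "\<dots> = complex_of_real (real N * (\<Sum>x\<in>?G. (f x)\<^sup>2))"
    by (simp add: sum_distrib_left power2_eq_square mult.commute)
  finally show ?thesis
    using of_real_eq_iff by blast
qed

text \<open>After expanding the three transforms and summing over \<theta> first, orthogonality
  keeps exactly the terms with \<open>w\<close> congruent to \<open>v + y\<close>. Periodicity of
  \<open>k\<close> lets \<open>v + y\<close> leave the range of least residues.\<close>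

lemma convolution_eq:
  assumes "periodic k"
  shows "complex_of_real (\<Sum>v\<in>{0..<int N}. \<Sum>y\<in>{0..<int N}. f v * h y * k (v + y)) * of_nat N
    = (\<Sum>\<theta>\<in>{0..<int N}. fourier f \<theta> * (fourier h \<theta> * cnj (fourier k \<theta>)))"
proof -
  let ?G = "{0..<int N}"
  have "(\<Sum>\<theta>\<in>?G. fourier f \<theta> * (fourier h \<theta> * cnj (fourier k \<theta>)))
    = (\<Sum>\<theta>\<in>?G. \<Sum>v\<in>?G. \<Sum>y\<in>?G. \<Sum>w\<in>?G. of_real (f v * h y * k w) * additive_char (\<theta> * (v + y - w)))"
    unfolding fourier_def cnj_sum
    unfolding sum_distrib_right
    unfolding sum_distrib_left
    by (intro sum.cong refl) (simp add: right_diff_distrib distrib_left char_add char_diff)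
  also have "\<dots> = (\<Sum>v\<in>?G. \<Sum>\<theta>\<in>?G. \<Sum>y\<in>?G. \<Sum>w\<in>?G. of_real (f v * h y * k w) * additive_char (\<theta> * (v + y - w)))"
    by (rule sum.swap)
  also have "\<dots> = (\<Sum>v\<in>?G. \<Sum>y\<in>?G. \<Sum>\<theta>\<in>?G. \<Sum>w\<in>?G. of_real (f v * h y * k w) * additive_char (\<theta> * (v + y - w)))"
    by (intro sum.cong refl sum.swap)
  also have "\<dots> = (\<Sum>v\<in>?G. \<Sum>y\<in>?G. \<Sum>w\<in>?G. \<Sum>\<theta>\<in>?G. of_real (f v * h y * k w) * additive_char (\<theta> * (v + y - w)))"
    by (intro sum.cong refl sum.swap)
  also have "\<dots> = (\<Sum>v\<in>?G. \<Sum>y\<in>?G. \<Sum>w\<in>?G. of_real (f v * h y * k w) * (if int N dvd v + y - w then of_nat N else 0))"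
    unfolding sum_distrib_left[symmetric] char_orthogonality ..
  also have "\<dots> = (\<Sum>v\<in>?G. \<Sum>y\<in>?G. of_real (f v * h y * k (v + y)) * of_nat N)"
  proof (intro sum.cong refl)
    fix v y
    have dvd_iff: "int N dvd v + y - w \<longleftrightarrow> w = (v + y) mod int N" if "w \<in> ?G" for w
      using that by (metis atLeastLessThan_iff mod_eq_dvd_iff mod_pos_pos_trivial)
    have "(\<Sum>w\<in>?G. of_real (f v * h y * k w) * (if int N dvd v + y - w then of_nat N else (0::complex)))
      = (\<Sum>w\<in>?G. if w = (v + y) mod int N then of_real (f v * h y * k w) * of_nat N else 0)"
      by (intro sum.cong refl) (simp add: dvd_iff)
    also have "\<dots> = of_real (f v * h y * k ((v + y) mod int N)) * of_nat N"
      using N_pos by simp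
    finally show "(\<Sum>w\<in>?G. of_real (f v * h y * k w) * (if int N dvd v + y - w then of_nat N else (0::complex)))
      = of_real (f v * h y * k (v + y)) * of_nat N"
      using assms by (simp add: periodic_def)
  qed
  also have "\<dots> = complex_of_real (\<Sum>v\<in>?G. \<Sum>y\<in>?G. f v * h y * k (v + y)) * of_nat N"
    by (simp add: sum_distrib_right)
  finally show ?thesis by simp
qed

text \<open>The transform of \<open>f\<close> is bounded uniformly, the other two are paired by
  Cauchy-Schwarz and Parseval. The factor \<open>N\<close> from Parseval cancels the one in
  \<open>convolution_eq\<close>.\<close>

lemma convolution_bound:
  assumes "periodic k" and bd: "\<And>\<theta>. cmod (fourier f \<theta>) \<le> C"
  shows "\<bar>\<Sum>v\<in>{0..<int N}. \<Sum>y\<in>{0..<int N}. f v * h y * k (v + y)\<bar>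
    \<le> C * sqrt ((\<Sum>x\<in>{0..<int N}. (h x)\<^sup>2) * (\<Sum>x\<in>{0..<int N}. (k x)\<^sup>2))"
proof -
  let ?G = "{0..<int N}"
  let ?S = "\<Sum>v\<in>?G. \<Sum>y\<in>?G. f v * h y * k (v + y)"
  let ?H = "\<Sum>x\<in>?G. (h x)\<^sup>2" and ?K = "\<Sum>x\<in>?G. (k x)\<^sup>2"
  have C0: "C \<ge> 0" using bd[of 0] norm_ge_zero order_trans by blast
  have "(\<Sum>\<theta>\<in>?G. cmod (fourier h \<theta>) * cmod (fourier k \<theta>))\<^sup>2 \<le> (real N * ?H) * (real N * ?K)"
    using Cauchy_Schwarz_ineq_sum[of "\<lambda>\<theta>. cmod (fourier h \<theta>)" "\<lambda>\<theta>. cmod (fourier k \<theta>)" ?G]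
    by (simp only: parseval)
  then have "(\<Sum>\<theta>\<in>?G. cmod (fourier h \<theta>) * cmod (fourier k \<theta>)) \<le> sqrt ((real N)\<^sup>2 * (?H * ?K))"
    by (intro real_le_rsqrt) (simp add: power2_eq_square mult_ac)
  also have "\<dots> = real N * sqrt (?H * ?K)"
    by (simp add: real_sqrt_mult)
  finally have cs: "(\<Sum>\<theta>\<in>?G. cmod (fourier h \<theta>) * cmod (fourier k \<theta>)) \<le> real N * sqrt (?H * ?K)" .
  have "\<bar>?S\<bar> * real N = cmod (complex_of_real ?S * of_nat N)"
    by (simp add: norm_mult del: of_real_sum)
  also have "\<dots> \<le> (\<Sum>\<theta>\<in>?G. cmod (fourier f \<theta>) * (cmod (fourier h \<theta>) * cmod (fourier k \<theta>)))"
    unfolding convolution_eq[OF assms(1)] by (rule order_trans[OF norm_sum]) (simp add: norm_mult)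
  also have "\<dots> \<le> (\<Sum>\<theta>\<in>?G. C * (cmod (fourier h \<theta>) * cmod (fourier k \<theta>)))"
    by (intro sum_mono mult_right_mono bd) simp
  also have "\<dots> \<le> C * (real N * sqrt (?H * ?K))"
    unfolding sum_distrib_left[symmetric] by (intro mult_left_mono cs C0)
  finally show ?thesis
    using N_pos by (simp add: mult_ac)
qed

subsection \<open>Averages and density increments\<close>

lemma card_reps_pos: "reps B \<noteq> {} \<Longrightarrow> 0 < real (card (reps B))"
  by (simp add: card_gt_0_iff)

lemma avg_mult_card: "reps B \<noteq> {} \<Longrightarrow> avg B F * real (card (reps B)) = (\<Sum>x\<in>reps B. F x)"
  by (simp add: avg_def)

lemma avg_const: "reps B \<noteq> {} \<Longrightarrow> avg B (\<lambda>x. c) = c"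
  by (simp add: avg_def)

lemma avg_diff: "avg B (\<lambda>x. F x - G x) = avg B F - avg B G"
  by (simp add: avg_def sum_subtractf diff_divide_distrib)

lemma avg_add: "avg B (\<lambda>x. F x + G x) = avg B F + avg B G"
  by (simp add: avg_def sum.distrib add_divide_distrib)

lemma avg_cmult: "avg B (\<lambda>x. c * F x) = c * avg B F"
  by (simp add: avg_def sum_distrib_left)

lemma avg_mono: "(\<And>x. x \<in> reps B \<Longrightarrow> F x \<le> G x) \<Longrightarrow> avg B F \<le> avg B G"
  unfolding avg_def by (intro divide_right_mono sum_mono) auto

lemma avg_attained: 
  assumes "reps B \<noteq> {}" shows "\<exists>x\<in>reps B. avg B F \<le> F x"
proof (rule ccontr)
  assume "\<not> ?thesis"
  then have "(\<Sum>x\<in>reps B. F x) < (\<Sum>x\<in>reps B. avg B F)"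
    using assms by (intro sum_strict_mono) (auto simp: not_le)
  then show False
    using assms by (simp add: avg_def)
qed

text \<open>Each single shift changes the average by at most \<epsilon>, hence so does their mean.
  The shifts form an indexed family so that it also covers the sums \<open>v + y\<close> over pairs,
  where values repeat, and the multiples \<open>a z\<close>.\<close>

lemma avg_shift_mean:
  fixes F :: "int \<Rightarrow> real"
  assumes inv: "almost_invariant \<epsilon> B U" and per: "periodic F" "periodic (\<lambda>x. x \<in> B)"
    and bd: "\<And>x. \<bar>F x\<bar> \<le> 1" and J: "finite J" "J \<noteq> {}" "\<And>j. j \<in> J \<Longrightarrow> s j \<in> U"
    and B: "reps B \<noteq> {}"
  shows "\<bar>avg B (\<lambda>x. (\<Sum>j\<in>J. F (x + s j)) / real (card J)) - avg B F\<bar> \<le> \<epsilon>"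
proof -
  have cJ: "real (card J) > 0" using J by (simp add: card_gt_0_iff)
  note cB = card_reps_pos[OF B]
  have 1: "\<bar>avg B (\<lambda>x. F (x + s j)) - avg B F\<bar> \<le> \<epsilon>" if "j \<in> J" for j
    using sum_translate[OF inv J(3)[OF that] per] bd cB
    by (simp add: avg_def diff_divide_distrib[symmetric] abs_divide pos_divide_le_eq)
  have "avg B (\<lambda>x. (\<Sum>j\<in>J. F (x + s j)) / real (card J)) = (\<Sum>j\<in>J. avg B (\<lambda>x. F (x + s j))) / real (card J)"
    unfolding avg_def by (simp add: sum_divide_distrib[symmetric] sum.swap[of _ J])
  also have "\<dots> - avg B F = (\<Sum>j\<in>J. avg B (\<lambda>x. F (x + s j)) - avg B F) / real (card J)"
    using cJ by (simp add: sum_subtractf diff_divide_distrib)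
  also have "\<bar>\<dots>\<bar> \<le> (\<Sum>j\<in>J. \<epsilon>) / real (card J)"
    unfolding abs_divide abs_of_pos[OF cJ]
    by (intro divide_right_mono order_trans[OF sum_abs] sum_mono 1) auto
  finally show ?thesis using cJ by simp
qed

lemma avg_avg:
  fixes F :: "int \<Rightarrow> real"
  assumes "almost_invariant \<epsilon> B U" "periodic F" "periodic (\<lambda>x. x \<in> B)"
    "\<And>x. \<bar>F x\<bar> \<le> 1" "reps U \<noteq> {}" "reps B \<noteq> {}"
  shows "\<bar>avg B (\<lambda>x. avg U (\<lambda>u. F (x + u))) - avg B F\<bar> \<le> \<epsilon>"
  using avg_shift_mean[of \<epsilon> B U F "reps U" "\<lambda>u. u"] assms unfolding avg_def reps_def by auto

lemma max_density_ge:
  assumes "periodic (\<lambda>x. x \<in> A)"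
  shows "avg B (\<lambda>b. indicator A (x + int a * b)) \<le> max_density A a B"
proof -
  have "avg B (\<lambda>b. indicator A (x + int a * b)) = avg B (\<lambda>b. indicator A (x mod int N + int a * b))"
  proof -
    have "periodic (\<lambda>y. indicator A (y + t) :: real)" for t
      by (intro periodic_comp periodic_indicator assms)
    then show ?thesis
      unfolding periodic_def by simp
  qed
  then show ?thesis
    unfolding max_density_def using N_pos by (intro Max_ge) auto
qed

lemma max_density_attained:
  "\<exists>x. max_density A a B = avg B (\<lambda>b. indicator A (x + int a * b))"
proof -
  have "max_density A a B \<in> (\<lambda>x. avg B (\<lambda>b. indicator A (x + int a * b))) ` {0..<int N}"
    unfolding max_density_def using N_pos by (intro Max_in) auto
  then show ?thesis by blast
qed

lemma max_density_le_1: "max_density A a B \<le> 1"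
proof -
  obtain x where x: "max_density A a B = avg B (\<lambda>b. indicator A (x + int a * b))"
    using max_density_attained by blast
  have "avg B (\<lambda>b. indicator A (x + int a * b)) \<le> avg B (\<lambda>b. 1)"
    by (intro avg_mono) (auto simp: indicator_def)
  also have "\<dots> \<le> 1" by (simp add: avg_def)
  finally show ?thesis using x by simp
qed

text \<open>An optimal translate of \<open>a Y\<close> is, up to \<epsilon>, an average of
  translates of \<open>a Z\<close>, and on none of these does the density exceed the
  maximum.\<close>

lemma max_density_mono:
  assumes A: "periodic (\<lambda>x. x \<in> A)" and inv: "almost_invariant \<epsilon> Y Z" "periodic (\<lambda>x. x \<in> Y)"
    and ne: "reps Z \<noteq> {}" "reps Y \<noteq> {}"
  shows "max_density A a Y - \<epsilon> \<le> max_density A a Z"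
proof -
  obtain x where x: "max_density A a Y = avg Y (\<lambda>b. indicator A (x + int a * b))"
    using max_density_attained by blast
  define F :: "int \<Rightarrow> real" where "F = (\<lambda>b. indicator A (x + int a * b))"
  have "periodic F"
    unfolding F_def by (intro periodic_comp periodic_indicator A)
  then have "avg Y F \<le> avg Y (\<lambda>y. avg Z (\<lambda>z. F (y + z))) + \<epsilon>"
    using avg_avg[OF inv(1) _ inv(2), of F] ne by (auto simp: F_def indicator_def abs_le_iff)
  also have "avg Y (\<lambda>y. avg Z (\<lambda>z. F (y + z))) \<le> avg Y (\<lambda>y. max_density A a Z)"
  proof (rule avg_mono)
    fix y
    show "avg Z (\<lambda>z. F (y + z)) \<le> max_density A a Z"
      using max_density_ge[OF A, of Z "x + int a * y" a] by (simp add: F_def algebra_simps)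
  qed
  finally show ?thesis
    using x ne by (simp add: F_def avg_const)
qed

text \<open>Since \<open>W\<close> hardly moves under shifts by \<open>a z\<close>, the density of
  \<open>A\<close> on \<open>W\<close> is nearly the mean of its densities on the translates
  \<open>w + a Z\<close>. This gives the increment when a class is dense on \<open>W\<close> but
  sparse on all translates of \<open>a Y\<close>.\<close>

lemma max_density_dilate:
  assumes A: "periodic (\<lambda>x. x \<in> A)" and inv: "almost_invariant \<epsilon> W ((\<lambda>z. int a * z) ` Z)" "periodic (\<lambda>x. x \<in> W)"
    and ne: "reps Z \<noteq> {}" "reps W \<noteq> {}"
  shows "avg W (indicator A) - \<epsilon> \<le> max_density A a Z"
proof -
  let ?F = "indicator A :: int \<Rightarrow> real"
  have "\<bar>avg W (\<lambda>w. (\<Sum>z\<in>reps Z. ?F (w + int a * z)) / real (card (reps Z))) - avg W ?F\<bar> \<le> \<epsilon>"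
  proof (rule avg_shift_mean[OF inv(1) periodic_indicator[OF A] inv(2)])
    show "\<bar>?F x\<bar> \<le> 1" for x by (simp add: indicator_def)
    show "int a * z \<in> (\<lambda>z. int a * z) ` Z" if "z \<in> reps Z" for z
      using that unfolding reps_def by blast
  qed (use ne in auto)
  then have "avg W ?F \<le> avg W (\<lambda>w. (\<Sum>z\<in>reps Z. ?F (w + int a * z)) / real (card (reps Z))) + \<epsilon>"
    by linarith
  also have "avg W (\<lambda>w. (\<Sum>z\<in>reps Z. ?F (w + int a * z)) / real (card (reps Z))) \<le> avg W (\<lambda>w. max_density A a Z)"
    using max_density_ge[OF A, of Z] by (intro avg_mono) (simp add: avg_def)
  finally show ?thesis using ne by (simp add: avg_const)
qed

text \<open>On \<open>Z\<close> the character of frequency \<theta> is nearly 1, so a large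
  coefficient forces the local sums of \<open>f\<close> over translates \<open>v + Z\<close> to be
  large in absolute value on average. As \<open>f\<close> has mean zero on \<open>V\<close>, these
  sums nearly cancel, so one of them is large and positive.\<close>

lemma fourier_increment:
  fixes f :: "int \<Rightarrow> real"
  assumes f: "periodic f" "\<And>x. \<bar>f x\<bar> \<le> 1" "(\<Sum>v\<in>reps V. f v) = 0"
    and V: "periodic (\<lambda>x. x \<in> V)" "reps V \<noteq> {}"
    and large: "\<kappa> * real (card (reps V)) \<le> cmod (\<Sum>v\<in>reps V. of_real (f v) * additive_char (\<theta> * v))"
    and inv: "almost_invariant \<epsilon> V Z" and Z: "reps Z \<noteq> {}" "\<And>u. u \<in> Z \<Longrightarrow> cmod (additive_char (\<theta> * u) - 1) \<le> \<epsilon>"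
    and \<kappa>: "3 * \<epsilon> < \<kappa>"
  shows "\<exists>v\<in>reps V. (\<kappa> - 3 * \<epsilon>) / 2 \<le> avg Z (\<lambda>u. f (v + u))"
proof (rule ccontr)
  assume neg: "\<not> ?thesis"
  let ?e = "\<lambda>x. additive_char (\<theta> * x)" and ?V = "reps V" and ?Z = "reps Z"
  let ?v = "real (card ?V)" and ?z = "real (card ?Z)"
  define S where "S = (\<Sum>v\<in>?V. of_real (f v) * ?e v)"
  define X where "X v = (\<Sum>u\<in>?Z. f (v + u))" for v
  have v0: "?v > 0" and z0: "?z > 0" using V(2) Z(1) by (blast intro: card_reps_pos)+
  have Zsub: "u \<in> Z" if "u \<in> ?Z" for u using that by (simp add: reps_def)
  \<comment> \<open>Two errors of relative size \<epsilon>: moving \<open>V\<close> by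
    \<open>u\<close>, and replacing the character at \<open>v + u\<close> by its value at
    \<open>v\<close>.\<close>
  have shift: "cmod ((\<Sum>v\<in>?V. of_real (f (v + u)) * ?e v) - S) \<le> 2 * \<epsilon> * ?v" if u: "u \<in> ?Z" for u
  proof -
    have per: "periodic (\<lambda>x. complex_of_real (f x) * ?e x)"
      using f(1) by (simp add: periodic_def char_mult_mod)
    have "cmod ((\<Sum>v\<in>?V. of_real (f (v + u)) * ?e (v + u)) - S) \<le> \<epsilon> * ?v"
      unfolding S_def using sum_translate[OF inv Zsub[OF u] per V(1)] f(2) by (simp add: norm_mult)
    moreover have "cmod ((\<Sum>v\<in>?V. of_real (f (v + u)) * ?e (v + u)) - (\<Sum>v\<in>?V. of_real (f (v + u)) * ?e v)) \<le> \<epsilon> * ?v"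
    proof -
      have "cmod (of_real (f (v + u)) * ?e (v + u) - of_real (f (v + u)) * ?e v) \<le> \<epsilon>" for v
      proof -
        have "of_real (f (v + u)) * ?e (v + u) - of_real (f (v + u)) * ?e v
          = of_real (f (v + u)) * ?e v * (?e u - 1)"
          by (simp add: distrib_left char_add algebra_simps)
        also have "cmod \<dots> \<le> 1 * \<epsilon>"
          unfolding norm_mult using f(2) Z(2)[OF Zsub[OF u]] by (intro mult_mono) auto
        finally show ?thesis by simp
      qed
      then have "cmod (\<Sum>v\<in>?V. of_real (f (v + u)) * ?e (v + u) - of_real (f (v + u)) * ?e v) \<le> (\<Sum>v\<in>?V. \<epsilon>)"
        by (intro sum_norm_le)
      then show ?thesis by (simp add: sum_subtractf mult.commute)
    qed
    ultimately have "cmod ((\<Sum>v\<in>?V. of_real (f (v + u)) * ?e v) - S) \<le> \<epsilon> * ?v + \<epsilon> * ?v"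
      by (intro norm_diff_triangle_le) (simp_all only: norm_minus_commute)
    then show ?thesis by simp
  qed
  have "cmod ((\<Sum>v\<in>?V. of_real (X v) * ?e v) - of_nat (card ?Z) * S)
      = cmod (\<Sum>u\<in>?Z. (\<Sum>v\<in>?V. of_real (f (v + u)) * ?e v) - S)"
    by (simp add: X_def sum_distrib_right sum_subtractf sum.swap[of _ ?Z])
  also have "\<dots> \<le> (\<Sum>u\<in>?Z. 2 * \<epsilon> * ?v)"
    by (intro sum_norm_le shift)
  finally have "cmod ((\<Sum>v\<in>?V. of_real (X v) * ?e v) - of_nat (card ?Z) * S) \<le> 2 * \<epsilon> * ?v * ?z"
    by (simp add: mult_ac)
  moreover have "\<kappa> * ?v * ?z \<le> cmod (of_nat (card ?Z) * S)"
    using large z0 by (simp add: norm_mult S_def)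
  moreover have "cmod (\<Sum>v\<in>?V. of_real (X v) * ?e v) \<le> (\<Sum>v\<in>?V. \<bar>X v\<bar>)"
    by (rule sum_norm_le) (simp add: norm_mult)
  ultimately have abs: "(\<kappa> - 2 * \<epsilon>) * ?v * ?z \<le> (\<Sum>v\<in>?V. \<bar>X v\<bar>)"
    using norm_triangle_sub[of "of_nat (card ?Z) * S" "\<Sum>v\<in>?V. of_real (X v) * ?e v"]
    by (simp add: algebra_simps norm_minus_commute)
  have "\<bar>avg V (\<lambda>v. avg Z (\<lambda>u. f (v + u))) - avg V f\<bar> \<le> \<epsilon>"
    by (rule avg_avg) (use inv f V Z in auto)
  then have "- \<epsilon> \<le> avg V (\<lambda>v. avg Z (\<lambda>u. f (v + u)))"
    using f(3) by (simp add: avg_def[of V f])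
  then have "- \<epsilon> \<le> (\<Sum>v\<in>?V. X v) / ?z / ?v"
    by (simp add: avg_def X_def sum_divide_distrib)
  then have sum: "- \<epsilon> * ?v * ?z \<le> (\<Sum>v\<in>?V. X v)"
    using v0 z0 by (simp add: pos_le_divide_eq field_simps)
  \<comment> \<open>The left side is 0 or \<open>2 * X v\<close>, so the negated claim bounds it.
    Adding \<open>abs\<close> and \<open>sum\<close> gives the same quantity as a lower bound for
    its total.\<close>
  have "\<bar>X v\<bar> + X v < (\<kappa> - 3 * \<epsilon>) * ?z" if "v \<in> ?V" for v
  proof -
    have "X v / ?z < (\<kappa> - 3 * \<epsilon>) / 2"
      using neg that by (auto simp: avg_def X_def not_le)
    then have "2 * X v < (\<kappa> - 3 * \<epsilon>) * ?z"
      using pos_divide_less_eq[OF z0, of "X v" "(\<kappa> - 3 * \<epsilon>) / 2"] by simp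
    moreover have "0 < (\<kappa> - 3 * \<epsilon>) * ?z" using \<kappa> z0 by simp
    ultimately show ?thesis by (auto simp: abs_if)
  qed
  then have "(\<Sum>v\<in>?V. \<bar>X v\<bar> + X v) < (\<Sum>v\<in>?V. (\<kappa> - 3 * \<epsilon>) * ?z)"
    using V by (intro sum_strict_mono) auto
  then show False
    using abs sum by (simp add: sum.distrib algebra_simps)
qed

text \<open>Let \<open>g\<close> be the indicator of \<open>(A - x) / a\<close> for an optimal
  \<open>x\<close>. Absence of solutions makes \<open>g (z + v) * g (z + v + y)\<close> vanish for
  \<open>y\<close> in \<open>A\<close>, so the balanced function of \<open>g\<close> on
  \<open>z + V\<close> has a large convolution sum, hence a large Fourier coefficient. The frequency
  is fixed before \<open>Z\<close>, because \<open>Z\<close> is later constructed from it.\<close>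

lemma density_increment:
  fixes \<tau> :: real
  assumes \<tau>: "0 < \<tau>" "\<tau> \<le> 1/2" and \<epsilon>_def: "\<epsilon> = \<tau> ^ 20"
    and A: "periodic (\<lambda>x. x \<in> A)" and nosol: "\<And>x y. x \<in> A \<Longrightarrow> y \<in> A \<Longrightarrow> x + int a * y \<notin> A"
    and per: "periodic (\<lambda>x. x \<in> Y)" "periodic (\<lambda>x. x \<in> W)" "periodic (\<lambda>x. x \<in> V)"
    and ne: "reps Y \<noteq> {}" "reps W \<noteq> {}" "reps V \<noteq> {}"
    and inv: "almost_invariant \<epsilon> Y V" "almost_invariant \<epsilon> Y {v + w |v w. v \<in> V \<and> w \<in> W}" "almost_invariant \<epsilon> W V"
    and dense: "\<tau> * real (card (reps W)) \<le> real (card (reps (A \<inter> W)))"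
    and M: "\<tau> / 2 \<le> max_density A a Y"
  shows "\<exists>\<theta>. \<forall>Z. reps Z \<noteq> {} \<longrightarrow> almost_invariant \<epsilon> V Z \<longrightarrow>
    (\<forall>u\<in>Z. cmod (additive_char (\<theta> * u) - 1) \<le> \<epsilon>) \<longrightarrow> max_density A a Y + \<tau> ^ 15 \<le> max_density A a Z"
proof -
  have half: "\<tau> ^ Suc n \<le> \<tau> ^ n / 2" for n
    using mult_right_mono[OF \<tau>(2), of "\<tau> ^ n"] \<tau>(1) by simp
  \<comment> \<open>A chain of halvings from which linear arithmetic derives all later comparisons
    between powers of \<tau>.\<close>
  have pows: "\<tau> ^ 2 \<le> \<tau> / 2" "\<tau> ^ 3 \<le> \<tau> ^ 2 / 2" "\<tau> ^ 4 \<le> \<tau> ^ 3 / 2" "\<tau> ^ 5 \<le> \<tau> ^ 4 / 2" "\<tau> ^ 6 \<le> \<tau> ^ 5 / 2"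
    "\<tau> ^ 7 \<le> \<tau> ^ 6 / 2" "\<tau> ^ 8 \<le> \<tau> ^ 7 / 2" "\<tau> ^ 9 \<le> \<tau> ^ 8 / 2" "\<tau> ^ 10 \<le> \<tau> ^ 9 / 2"
    "\<tau> ^ 11 \<le> \<tau> ^ 10 / 2" "\<tau> ^ 12 \<le> \<tau> ^ 11 / 2" "\<tau> ^ 13 \<le> \<tau> ^ 12 / 2" "\<tau> ^ 14 \<le> \<tau> ^ 13 / 2"
    "\<tau> ^ 15 \<le> \<tau> ^ 14 / 2" "\<tau> ^ 16 \<le> \<tau> ^ 15 / 2" "\<tau> ^ 17 \<le> \<tau> ^ 16 / 2" "\<tau> ^ 18 \<le> \<tau> ^ 17 / 2"
    "\<tau> ^ 19 \<le> \<tau> ^ 18 / 2" "\<tau> ^ 20 \<le> \<tau> ^ 19 / 2" "0 < \<tau> ^ 20"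
    using zero_less_power[OF \<tau>(1), of 20] half[of 1] half[of 2] half[of 3] half[of 4] half[of 5] half[of 6] half[of 7] half[of 8] half[of 9]
      half[of 10] half[of 11] half[of 12] half[of 13] half[of 14] half[of 15] half[of 16] half[of 17] half[of 18] half[of 19]
    by (simp_all only: Suc_1 eval_nat_numeral power_one_right) (simp_all add: eval_nat_numeral)
  let ?M = "max_density A a Y" and ?H = "reps (A \<inter> W)" and ?V = "reps V" and ?W = "reps W"
  let ?v = "real (card ?V)" and ?w = "real (card ?W)" and ?h = "real (card ?H)"
  have v0: "?v > 0" and w0: "?w > 0" using ne(2,3) by (blast intro: card_reps_pos)+
  have h0: "?h > 0" using dense mult_pos_pos[OF \<tau>(1) w0] by linarith
  obtain x where x: "?M = avg Y (\<lambda>b. indicator A (x + int a * b))"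
    using max_density_attained by blast
  define g :: "int \<Rightarrow> real" where "g = (\<lambda>b. indicator A (x + int a * b))"
  have g: "periodic g" unfolding g_def by (intro periodic_comp periodic_indicator A)
  have g01: "0 \<le> g b" "g b \<le> 1" "\<bar>g b\<bar> \<le> 1" for b by (simp_all add: g_def indicator_def)
  have M: "?M = avg Y g" by (simp add: x g_def)
  have density: "avg Z (\<lambda>u. g (z + u)) \<le> max_density A a Z" for z Z
    using max_density_ge[OF A, of Z "x + int a * z" a] by (simp add: g_def algebra_simps)
  \<comment> \<open>Here \<open>p z\<close> is the density of \<open>g\<close> on
    \<open>z + V\<close>, while \<open>q z\<close> is its mean over the sums
    \<open>z + v + y\<close> with \<open>y\<close> in the class itself. The goal is a point
    \<open>z\<close> where \<open>p z\<close> is close to the maximum and \<open>q z\<close> is not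
    small.\<close>
  define p where "p = (\<lambda>z. avg V (\<lambda>v. g (z + v)))"
  define q where "q = (\<lambda>z. (\<Sum>(v, y)\<in>?V \<times> ?H. g (z + (v + y))) / real (card (?V \<times> ?H)))"
  show ?thesis
  proof (cases "\<exists>z. p z \<ge> ?M + 2 * \<tau> ^ 15")
    \<comment> \<open>A translate of \<open>a V\<close> is already denser, and passing to
      \<open>Z\<close> loses only \<epsilon>, so every frequency will do.\<close>
    case True
    then have V: "?M + 2 * \<tau> ^ 15 \<le> max_density A a V"
      using density[of V] unfolding p_def by (meson order_trans)
    have "?M + \<tau> ^ 15 \<le> max_density A a Z" if "reps Z \<noteq> {}" "almost_invariant \<epsilon> V Z" for Z
      using max_density_mono[OF A that(2) per(3) that(1) ne(3), of a] V pows \<epsilon>_def \<tau>(1) by linarith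
    then show ?thesis by blast
  next
    case False
    then have p_lt: "p z < ?M + 2 * \<tau> ^ 15" for z by (simp add: not_le)
    \<comment> \<open>The weight is large enough that \<open>q z \<le> 1\<close> keeps
      \<open>p z\<close> within about \<open>\<tau> ^ 10\<close> of the maximum, and small enough
      that \<open>K * 2 * \<tau> ^ 15 = 2 * \<tau> ^ 5\<close> is negligible against
      \<open>\<tau> / 2\<close>.\<close>
    define K where "K = 1 / \<tau> ^ 10"
    have K0: "K > 0" using \<tau> by (simp add: K_def)
    have "?M - \<epsilon> \<le> avg Y p"
      using avg_avg[OF inv(1) g per(1) g01(3) ne(3,1)] by (simp add: M p_def)
    moreover have "?M - \<epsilon> \<le> avg Y q"
    proof -
      have "\<bar>avg Y (\<lambda>z. (\<Sum>j\<in>?V \<times> ?H. g (z + (fst j + snd j))) / real (card (?V \<times> ?H))) - avg Y g\<bar> \<le> \<epsilon>"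
      proof (rule avg_shift_mean[OF inv(2) g per(1) g01(3)])
        show "?V \<times> ?H \<noteq> {}" using v0 h0 by auto
      qed (use ne in \<open>auto simp: reps_def\<close>)
      then show ?thesis by (simp add: M q_def case_prod_unfold)
    qed
    \<comment> \<open>As \<open>p \<le> M + 2 \<tau>^15\<close> everywhere and \<open>q \<le> 1\<close>, a point where \<open>q + K p\<close> is at least its average
      has both \<open>q\<close> bounded below and \<open>p\<close> within \<open>1 / K\<close> of \<open>M\<close>, up to smaller terms.\<close>
    ultimately have "(1 + K) * (?M - \<epsilon>) \<le> avg Y (\<lambda>z. q z + K * p z)"
      unfolding avg_add avg_cmult distrib_right using K0 by (intro add_mono mult_left_mono) auto
    then obtain z where z: "(1 + K) * (?M - \<epsilon>) \<le> q z + K * p z"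
      using avg_attained[OF ne(1), of "\<lambda>z. q z + K * p z"] by (meson order_trans)
    define m where "m = p z"
    have "q z \<ge> ?M - \<epsilon> - K * (\<epsilon> + 2 * \<tau> ^ 15)"
    proof -
      have "K * p z \<le> K * (?M + 2 * \<tau> ^ 15)"
        using K0 p_lt[of z] by (intro mult_left_mono) auto
      then show ?thesis using z by (simp add: algebra_simps)
    qed
    moreover have "K * (\<epsilon> + 2 * \<tau> ^ 15) = \<tau> ^ 10 + 2 * \<tau> ^ 5"
    proof -
      have "\<tau> ^ 20 = \<tau> ^ 10 * \<tau> ^ 10" "\<tau> ^ 15 = \<tau> ^ 10 * \<tau> ^ 5" by (simp_all flip: power_add)
      then have "K * (\<epsilon> + 2 * \<tau> ^ 15) = (K * \<tau> ^ 10) * (\<tau> ^ 10 + 2 * \<tau> ^ 5)"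
        unfolding \<epsilon>_def by (simp only: algebra_simps)
      also have "K * \<tau> ^ 10 = 1" using \<tau>(1) by (simp add: K_def)
      finally show ?thesis by simp
    qed
    ultimately have q: "q z \<ge> ?M / 2"
      using \<open>\<tau> / 2 \<le> ?M\<close> pows \<tau>(1) unfolding \<epsilon>_def by linarith
    have "q z \<le> 1"
    proof -
      have "(\<Sum>(v, y)\<in>?V \<times> ?H. g (z + (v + y))) \<le> (\<Sum>j\<in>?V \<times> ?H. 1)"
        by (intro sum_mono) (auto simp: g01)
      then show ?thesis 
        using v0 h0 mult_pos_pos[OF v0 h0] by (simp add: q_def divide_le_eq_1)
    qed
    then have "K * (?M - \<epsilon> - p z) \<le> 1"
      using z \<open>\<tau> / 2 \<le> ?M\<close> pows \<tau>(1) unfolding \<epsilon>_def by (simp add: algebra_simps)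
    then have m: "m \<ge> ?M - \<epsilon> - \<tau> ^ 10"
      using \<tau>(1) by (simp add: K_def m_def divide_simps)
    then have m2: "m \<ge> ?M / 2" 
      using \<open>\<tau> / 2 \<le> ?M\<close> pows \<tau>(1) unfolding \<epsilon>_def by linarith
    have m01: "0 \<le> m" "m \<le> 1"
      using m2 \<open>\<tau> / 2 \<le> ?M\<close> \<tau>(1) density[of V z] max_density_le_1[of A a V] unfolding m_def p_def by linarith+
    define f where "f = (\<lambda>v. g (z + v) - m)"
    have f: "periodic f" unfolding f_def using periodic_map[OF periodic_comp(2)[OF g], of "\<lambda>y. y - m"] .
    have f1: "\<bar>f v\<bar> \<le> 1" for v using g01[of "z + v"] m01 unfolding f_def by linarith
    have f0: "(\<Sum>v\<in>?V. f v) = 0"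
      using avg_mult_card[OF ne(3), of "\<lambda>v. g (z + v)"] by (simp add: f_def sum_subtractf m_def p_def mult.commute)
    define F where "F = (\<lambda>v. indicator V v * f v)"
    define h :: "int \<Rightarrow> real" where "h = indicator (A \<inter> W)"
    \<comment> \<open>Cutting off to \<open>W\<close> keeps the sum of squares at most
      \<open>card (reps W)\<close> rather than of order \<open>N\<close>. The cost is the error
      \<open>err\<close>, small because shifts by elements of \<open>V\<close> push few points out
      of \<open>W\<close>.\<close>
    define k where "k = (\<lambda>u. indicator W u * g (z + u))"
    have k: "periodic k"
      unfolding k_def using periodic_combine[OF periodic_indicator[OF per(2)] periodic_comp(2)[OF g], of "(*)" z] .
    have main: "(\<Sum>v\<in>?V. \<Sum>y\<in>?H. f v * g (z + (v + y))) = - (m * q z * ?v * ?h)"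
    proof -
      \<comment> \<open>The points \<open>x + a (z + v)\<close>, \<open>y\<close> and
        \<open>x + a (z + v + y)\<close> would form a solution inside \<open>A\<close>. Hence only
        the constant \<open>- m\<close> of the balanced function survives in the sum.\<close>
      have "g (z + v) * g (z + (v + y)) = 0" if "v \<in> ?V" "y \<in> ?H" for v y
        using nosol[of "x + int a * (z + v)" y] that
        by (auto simp: g_def indicator_def reps_def algebra_simps)
      then have "(\<Sum>v\<in>?V. \<Sum>y\<in>?H. f v * g (z + (v + y))) = (\<Sum>v\<in>?V. \<Sum>y\<in>?H. - m * g (z + (v + y)))"
        by (intro sum.cong refl) (simp add: f_def left_diff_distrib)
      also have "\<dots> = - m * (\<Sum>(v, y)\<in>?V \<times> ?H. g (z + (v + y)))"
        by (simp add: sum.cartesian_product sum_distrib_left case_prod_unfold)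
      also have "(\<Sum>(v, y)\<in>?V \<times> ?H. g (z + (v + y))) = q z * ?v * ?h"
        using v0 h0 by (simp add: q_def card_cartesian_product)
      finally show ?thesis by simp
    qed
    have conv: "(\<Sum>v\<in>{0..<int N}. \<Sum>y\<in>{0..<int N}. F v * h y * k (v + y))
        = (\<Sum>v\<in>?V. \<Sum>y\<in>?H. f v * (indicator W (v + y) * g (z + (v + y))))"
      unfolding sum_reps_indicator F_def h_def k_def real_scaleR_def sum_distrib_left
      by (simp add: mult_ac)
    have err: "\<bar>(\<Sum>v\<in>?V. \<Sum>y\<in>?H. f v * g (z + (v + y)))
        - (\<Sum>v\<in>{0..<int N}. \<Sum>y\<in>{0..<int N}. F v * h y * k (v + y))\<bar> \<le> \<epsilon> * ?v * ?w"
    proof -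
      have "\<bar>\<Sum>y\<in>?H. f v * g (z + (v + y)) - f v * (indicator W (v + y) * g (z + (v + y)))\<bar> \<le> \<epsilon> * ?w"
        if v: "v \<in> ?V" for v
      proof -
        have "\<bar>\<Sum>y\<in>?H. f v * g (z + (v + y)) - f v * (indicator W (v + y) * g (z + (v + y)))\<bar>
          \<le> (\<Sum>y\<in>?H. 1 - indicator W (v + y))"
          using f1[of v] by (intro order_trans[OF sum_abs] sum_mono) (auto simp: indicator_def g_def)
        also have "\<dots> \<le> (\<Sum>y\<in>?W. 1 - indicator W (v + y))"
          by (intro sum_mono2) (auto simp: reps_def indicator_def)
        also have "\<dots> = (\<Sum>y\<in>?W. indicator W y) - (\<Sum>y\<in>?W. indicator W (y + v))"
          by (simp add: sum_subtractf add.commute reps_def)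
        also have "\<dots> \<le> \<epsilon> * ?w"
        proof -
          have "norm ((\<Sum>y\<in>?W. indicator W (y + v)) - (\<Sum>y\<in>?W. indicator W y :: real)) \<le> \<epsilon> * ?w"
            by (rule sum_translate[OF inv(3) _ periodic_indicator[OF per(2)] per(2)])
               (use v in \<open>auto simp: reps_def indicator_def\<close>)
          then show ?thesis by (simp only: real_norm_def abs_le_iff) linarith
        qed
        finally show ?thesis .
      qed
      then have "(\<Sum>v\<in>?V. \<bar>\<Sum>y\<in>?H. f v * g (z + (v + y)) - f v * (indicator W (v + y) * g (z + (v + y)))\<bar>)
          \<le> (\<Sum>v\<in>?V. \<epsilon> * ?w)"
        by (intro sum_mono)
      then show ?thesis
        unfolding conv sum_subtractf[symmetric] by (intro order_trans[OF sum_abs]) (simp add: mult_ac)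
    qed
    \<comment> \<open>Both \<open>m\<close> and \<open>q z\<close> are at least
      \<open>\<tau> / 4\<close>, and \<open>A\<close> has density at least \<tau> on
      \<open>W\<close>, so the sum has relative size at least \<open>\<tau> ^ 3 / 16\<close>.
      Coefficients all below \<open>\<tau> ^ 8\<close> would leave at most
      \<open>\<tau> ^ 8 + \<epsilon>\<close>.\<close>
    have "\<exists>\<theta>. \<tau> ^ 8 * ?v \<le> cmod (fourier F \<theta>)"
    proof (rule ccontr)
      assume "\<not> ?thesis"
      then have "cmod (fourier F \<theta>) \<le> \<tau> ^ 8 * ?v" for \<theta> by (meson linear)
      from convolution_bound[OF k this, of h]
      have "\<bar>\<Sum>v\<in>{0..<int N}. \<Sum>y\<in>{0..<int N}. F v * h y * k (v + y)\<bar>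
        \<le> \<tau> ^ 8 * ?v * sqrt ((\<Sum>x\<in>{0..<int N}. (h x)\<^sup>2) * (\<Sum>x\<in>{0..<int N}. (k x)\<^sup>2))" .
      also have "\<dots> \<le> \<tau> ^ 8 * ?v * ?w"
      proof -
        have "(\<Sum>x\<in>{0..<int N}. (h x)\<^sup>2) \<le> (\<Sum>x\<in>{0..<int N}. indicator W x)"
          "(\<Sum>x\<in>{0..<int N}. (k x)\<^sup>2) \<le> (\<Sum>x\<in>{0..<int N}. indicator W x)"
          by (intro sum_mono; simp add: h_def k_def indicator_def g_def)+
        moreover have "(\<Sum>x\<in>{0..<int N}. indicator W x) = ?w"
          using sum_reps_indicator[of "\<lambda>_. 1::real" W] by simp
        ultimately have "(\<Sum>x\<in>{0..<int N}. (h x)\<^sup>2) * (\<Sum>x\<in>{0..<int N}. (k x)\<^sup>2) \<le> ?w * ?w"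
          by (intro mult_mono) (auto intro: sum_nonneg)
        then have "sqrt ((\<Sum>x\<in>{0..<int N}. (h x)\<^sup>2) * (\<Sum>x\<in>{0..<int N}. (k x)\<^sup>2)) \<le> ?w"
          using real_sqrt_le_mono by fastforce
        then show ?thesis using \<tau>(1) by (intro mult_left_mono) auto
      qed
      finally have "m * q z * ?v * ?h \<le> \<tau> ^ 8 * ?v * ?w + \<epsilon> * ?v * ?w"
        using err unfolding main by linarith
      then have "(m * q z * ?h) * ?v \<le> ((\<tau> ^ 8 + \<epsilon>) * ?w) * ?v"
        by (simp add: algebra_simps)
      then have "m * q z * ?h \<le> (\<tau> ^ 8 + \<epsilon>) * ?w"
        using v0 by (simp only: mult_le_cancel_right_pos)
      moreover have "(\<tau> / 4) * (\<tau> / 4) * (\<tau> * ?w) \<le> m * q z * ?h"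
        using m2 q \<open>\<tau> / 2 \<le> ?M\<close> \<tau>(1) dense by (intro mult_mono) auto
      ultimately have "(\<tau> ^ 3 / 16) * ?w \<le> (\<tau> ^ 8 + \<epsilon>) * ?w"
        by (simp add: power3_eq_cube)
      then have "\<tau> ^ 3 / 16 \<le> \<tau> ^ 8 + \<epsilon>"
        using w0 by (simp only: mult_le_cancel_right_pos)
      then show False using pows \<tau>(1) unfolding \<epsilon>_def by linarith
    qed
    then obtain \<theta> where "\<tau> ^ 8 * ?v \<le> cmod (fourier F \<theta>)" by blast
    moreover have "fourier F \<theta> = (\<Sum>v\<in>?V. of_real (f v) * additive_char (\<theta> * v))"
      unfolding fourier_def sum_reps_indicator F_def by (intro sum.cong refl) (simp add: indicator_def)
    ultimately have \<theta>: "\<tau> ^ 8 * ?v \<le> cmod (\<Sum>v\<in>?V. of_real (f v) * additive_char (\<theta> * v))" by simp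
    have "?M + \<tau> ^ 15 \<le> max_density A a Z" if Z: "reps Z \<noteq> {}" "almost_invariant \<epsilon> V Z"
        "\<forall>u\<in>Z. cmod (additive_char (\<theta> * u) - 1) \<le> \<epsilon>" for Z
    proof -
      have "3 * \<epsilon> < \<tau> ^ 8" using pows \<tau>(1) unfolding \<epsilon>_def by linarith
      then obtain v where v: "(\<tau> ^ 8 - 3 * \<epsilon>) / 2 \<le> avg Z (\<lambda>u. f (v + u))"
        using fourier_increment[OF f f1 f0 per(3) ne(3) \<theta> Z(2,1)] Z(3) by blast
      have "avg Z (\<lambda>u. f (v + u)) = avg Z (\<lambda>u. g ((z + v) + u)) - m"
        unfolding f_def avg_diff using Z(1) by (simp add: avg_const add.assoc)
      then have "m + (\<tau> ^ 8 - 3 * \<epsilon>) / 2 \<le> max_density A a Z"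
        using v density[of Z "z + v"] by linarith
      \<comment> \<open>The gain of about \<open>\<tau> ^ 8 / 2\<close> outweighs the loss
        \<open>\<epsilon> + \<tau> ^ 10\<close> incurred by replacing the maximal density with
        \<open>m\<close>.\<close>
      moreover have "\<tau> ^ 10 \<le> \<tau> ^ 8 / 4" "\<tau> ^ 15 \<le> \<tau> ^ 10 / 32" "\<tau> ^ 20 \<le> \<tau> ^ 15 / 32" "0 < \<tau> ^ 15"
        using pows by linarith+
      moreover have "D + t15 \<le> D'" if "m + (t8 - 3 * t20) / 2 \<le> D'" "t10 \<le> t8 / 4" "t15 \<le> t10 / 32"
          "t20 \<le> t15 / 32" "0 < t15" "m \<ge> D - t20 - t10" for D D' t8 t10 t15 t20 :: real
        using that by argo
      ultimately show ?thesis
        using m unfolding \<epsilon>_def by blast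
    qed
    then show ?thesis by blast
  qed
qed

subsection \<open>Bohr sets\<close>

text \<open>The existence of \<open>k\<close> says that \<open>\<gamma> * x / N\<close> is within
  \<rho> of an integer; naming \<open>k\<close> avoids a distance to the nearest integer.\<close>

definition bohr :: "int set \<Rightarrow> real \<Rightarrow> int set" where
  "bohr \<Gamma> \<rho> = {x. \<forall>\<gamma>\<in>\<Gamma>. \<exists>k. \<bar>real_of_int (\<gamma> * x - k * int N)\<bar> \<le> \<rho> * real N}"

lemma periodic_bohr: "periodic (\<lambda>x. x \<in> bohr \<Gamma> \<rho>)"
proof -
  have "(\<exists>k. \<bar>real_of_int (\<gamma> * (x mod int N) - k * int N)\<bar> \<le> \<rho> * real N)
    \<longleftrightarrow> (\<exists>k. \<bar>real_of_int (\<gamma> * x - k * int N)\<bar> \<le> \<rho> * real N)" (is "?L \<longleftrightarrow> ?R") for \<gamma> x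
  proof -
    have *: "\<gamma> * (x mod int N) = \<gamma> * x - \<gamma> * (x div int N) * int N"
      by (simp add: minus_mult_div_eq_mod[symmetric] algebra_simps)
    have "\<gamma> * (x mod int N) - k * int N = \<gamma> * x - (k + \<gamma> * (x div int N)) * int N" for k
      unfolding * by (simp add: algebra_simps)
    moreover have "\<gamma> * x - k * int N = \<gamma> * (x mod int N) - (k - \<gamma> * (x div int N)) * int N" for k
      unfolding * by (simp add: algebra_simps)
    ultimately show ?thesis by metis
  qed
  then show ?thesis by (simp add: periodic_def bohr_def)
qed

lemma zero_in_bohr: "0 \<le> \<rho> \<Longrightarrow> 0 \<in> bohr \<Gamma> \<rho>"
  unfolding bohr_def by (intro CollectI ballI exI[of _ 0]) simp

lemma bohr_mono: "\<rho> \<le> \<sigma> \<Longrightarrow> \<Gamma> \<subseteq> \<Gamma>' \<Longrightarrow> bohr \<Gamma>' \<rho> \<subseteq> bohr \<Gamma> \<sigma>"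
proof
  fix x assume "\<rho> \<le> \<sigma>" "\<Gamma> \<subseteq> \<Gamma>'" and x: "x \<in> bohr \<Gamma>' \<rho>"
  then have "\<rho> * real N \<le> \<sigma> * real N" by (intro mult_right_mono) auto
  then have le: "t \<le> \<sigma> * real N" if "t \<le> \<rho> * real N" for t using that by linarith
  show "x \<in> bohr \<Gamma> \<sigma>"
    using x \<open>\<Gamma> \<subseteq> \<Gamma>'\<close> le unfolding bohr_def by blast
qed

lemma bohr_add:
  assumes "x \<in> bohr \<Gamma> \<rho>" "y \<in> bohr \<Gamma> \<sigma>" shows "x + y \<in> bohr \<Gamma> (\<rho> + \<sigma>)"
  unfolding bohr_def
proof (intro CollectI ballI)
  fix \<gamma> assume "\<gamma> \<in> \<Gamma>"
  then obtain k l where "\<bar>real_of_int (\<gamma> * x - k * int N)\<bar> \<le> \<rho> * real N" "\<bar>real_of_int (\<gamma> * y - l * int N)\<bar> \<le> \<sigma> * real N"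
    using assms unfolding bohr_def by blast
  then show "\<exists>k. \<bar>real_of_int (\<gamma> * (x + y) - k * int N)\<bar> \<le> (\<rho> + \<sigma>) * real N"
    by (intro exI[of _ "k + l"]) (simp add: algebra_simps abs_le_iff)
qed

lemma bohr_minus:
  assumes "x \<in> bohr \<Gamma> \<rho>" shows "- x \<in> bohr \<Gamma> \<rho>"
  unfolding bohr_def
proof (intro CollectI ballI)
  fix \<gamma> assume "\<gamma> \<in> \<Gamma>"
  then obtain k where "\<bar>real_of_int (\<gamma> * x - k * int N)\<bar> \<le> \<rho> * real N"
    using assms unfolding bohr_def by blast
  then show "\<exists>k. \<bar>real_of_int (\<gamma> * (- x) - k * int N)\<bar> \<le> \<rho> * real N"
    by (intro exI[of _ "- k"]) (simp add: abs_le_iff)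
qed

text \<open>A frequency \<gamma> acts on \<open>b * x\<close> as \<open>\<gamma> * b\<close> acts on
  \<open>x\<close>. With \<open>b = a\<close> this is why frequency sets carry powers of
  \<open>a\<close>: dilates of a Bohr set then stay in a Bohr set of the previous stage.\<close>

lemma bohr_dilate:
  assumes "x \<in> bohr \<Gamma>' \<rho>" "\<And>\<gamma>. \<gamma> \<in> \<Gamma> \<Longrightarrow> \<gamma> * b \<in> \<Gamma>'"
  shows "b * x \<in> bohr \<Gamma> \<rho>"
  unfolding bohr_def
proof (intro CollectI ballI)
  fix \<gamma> assume "\<gamma> \<in> \<Gamma>"
  then have "\<exists>k. \<bar>real_of_int ((\<gamma> * b) * x - k * int N)\<bar> \<le> \<rho> * real N"
    using assms unfolding bohr_def by blast
  then show "\<exists>k. \<bar>real_of_int (\<gamma> * (b * x) - k * int N)\<bar> \<le> \<rho> * real N"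
    by (simp only: mult.assoc)
qed

lemma bohr_char:
  assumes "u \<in> bohr \<Gamma> \<rho>" "\<theta> \<in> \<Gamma>"
  shows "cmod (additive_char (\<theta> * u) - 1) \<le> 7 * \<rho>"
proof -
  obtain k where k: "\<bar>real_of_int (\<theta> * u - k * int N)\<bar> \<le> \<rho> * real N"
    using assms unfolding bohr_def by blast
  define t where "t = 2 * pi * real_of_int (\<theta> * u - k * int N) / real N"
  have "additive_char (\<theta> * u) = additive_char (\<theta> * u - k * int N)"
    by (metis char_mod minus_mod_self2 mod_diff_right_eq mod_mult_self2_is_0 diff_zero)
  also have "\<dots> = exp (\<i> * of_real t)"
    by (simp add: additive_char_def t_def cis_conv_exp)
  finally have "cmod (additive_char (\<theta> * u) - 1) = 2 * \<bar>sin (t / 2)\<bar>"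
    by (simp add: dist_exp_i_1)
  also have "\<dots> \<le> \<bar>t\<bar>"
    using abs_sin_x_le_abs_x[of "t / 2"] by simp
  also have "\<bar>t\<bar> = 2 * pi * (\<bar>real_of_int (\<theta> * u - k * int N)\<bar> / real N)"
    by (simp add: t_def abs_mult)
  also have "\<dots> \<le> 2 * pi * \<rho>"
    using k N_pos by (intro mult_left_mono) (simp_all add: pos_divide_le_eq)
  also have "\<dots> \<le> 7 * \<rho>"
  proof (rule mult_right_mono)
    show "2 * pi \<le> 7" using pi_less_4 pi_approx by simp
    have "0 \<le> \<rho> * real N" using k by linarith
    then show "0 \<le> \<rho>" using N_pos by (simp add: zero_le_mult_iff)
  qed
  finally show ?thesis .
qed

text \<open>Two residues in the same cell of the grid of mesh \<open>1 / q\<close> in the torus differ by an element of the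
  Bohr set.\<close>

lemma card_bohr:
  assumes "finite \<Gamma>" "q > 0"
  shows "N \<le> card (reps (bohr \<Gamma> (1 / real q))) * q ^ card \<Gamma>"
proof -
  let ?G = "{0..<int N}"
  let ?B = "PiE \<Gamma> (\<lambda>_. {0..<int q})"
  define cell where "cell x = restrict (\<lambda>\<gamma>. (int q * ((\<gamma> * x) mod int N)) div int N) \<Gamma>" for x
  have "cell \<in> ?G \<rightarrow> ?B"
  proof (intro Pi_I PiE_I)
    fix x \<gamma> assume "\<gamma> \<in> \<Gamma>"
    have "int q * ((\<gamma> * x) mod int N) < int q * int N"
      using assms(2) N_pos by (intro mult_strict_left_mono) auto
    then have "(int q * ((\<gamma> * x) mod int N)) div int N < int q"
    proof (rule contrapos_pp)
      let ?t = "int q * ((\<gamma> * x) mod int N)"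
      assume "\<not> ?t div int N < int q"
      then have "int q * int N \<le> ?t div int N * int N" by (intro mult_right_mono) auto
      also have "\<dots> = ?t - ?t mod int N" by (rule minus_mod_eq_div_mult[symmetric])
      also have "\<dots> \<le> ?t" using N_pos by simp
      finally show "\<not> ?t < int q * int N" by simp
    qed
    then show "cell x \<gamma> \<in> {0..<int q}"
      using \<open>\<gamma> \<in> \<Gamma>\<close> N_pos by (simp add: cell_def pos_imp_zdiv_nonneg_iff)
  qed (simp add: cell_def)
  moreover have "?B \<noteq> {}" using assms(2) by (auto simp: PiE_eq_empty_iff)
  moreover have "finite ?B" using assms by (intro finite_PiE) auto
  ultimately obtain y where y: "card (cell -` {y} \<inter> ?G) * card ?B \<ge> card ?G"
    using pigeonhole_card[of cell ?G ?B] by auto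
  have cardB: "card ?B = q ^ card \<Gamma>" using assms by (simp add: card_PiE)
  let ?F = "cell -` {y} \<inter> ?G"
  have "?F \<noteq> {}" 
  proof
    assume "?F = {}"
    with y N_pos show False by simp
  qed
  \<comment> \<open>Differences from one fixed point embed a well-filled cell into the Bohr
    set.\<close>
  then obtain x0 where x0: "x0 \<in> ?F" by blast
  have "card ?F \<le> card (reps (bohr \<Gamma> (1 / real q)))"
  proof (rule card_inj_on_le)
    show "inj_on (\<lambda>x. (x - x0) mod int N) ?F"
    proof (rule inj_onI)
      fix x x' assume *: "x \<in> ?F" "x' \<in> ?F" "(x - x0) mod int N = (x' - x0) mod int N"
      then have "int N dvd x - x'" by (simp add: mod_eq_dvd_iff)
      then show "x = x'" using * eq_if_dvd_diff by blast
    qed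
    show "(\<lambda>x. (x - x0) mod int N) ` ?F \<subseteq> reps (bohr \<Gamma> (1 / real q))"
    proof (intro image_subsetI)
      fix x assume x: "x \<in> ?F"
      have "x - x0 \<in> bohr \<Gamma> (1 / real q)"
        unfolding bohr_def
      proof (intro CollectI ballI)
        fix \<gamma> assume \<gamma>: "\<gamma> \<in> \<Gamma>"
        define s s0 where "s = (\<gamma> * x) mod int N" and "s0 = (\<gamma> * x0) mod int N"
        have "cell x \<gamma> = cell x0 \<gamma>" using x x0 by simp
        then have "(int q * s) div int N = (int q * s0) div int N"
          using \<gamma> by (simp add: cell_def s_def s0_def)
        then have "int q * s - (int q * s) mod int N = int q * s0 - (int q * s0) mod int N"
          by (simp only: minus_mod_eq_div_mult)
        moreover have "0 \<le> (int q * s) mod int N" "(int q * s) mod int N < int N"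
          "0 \<le> (int q * s0) mod int N" "(int q * s0) mod int N < int N"
          using N_pos by simp_all
        ultimately have "\<bar>int q * s - int q * s0\<bar> \<le> int N" by linarith
        then have "int q * \<bar>s - s0\<bar> \<le> int N"
          by (simp add: abs_mult flip: right_diff_distrib)
        then have "real_of_int (int q * \<bar>s - s0\<bar>) \<le> real_of_int (int N)"
          by (simp only: of_int_le_iff)
        then have "real q * \<bar>real_of_int (s - s0)\<bar> \<le> real N"
          by simp
        then have 1: "\<bar>real_of_int (s - s0)\<bar> \<le> 1 / real q * real N"
          using assms(2) by (simp add: field_simps)
        have "s = \<gamma> * x - (\<gamma> * x) div int N * int N" "s0 = \<gamma> * x0 - (\<gamma> * x0) div int N * int N"
          unfolding s_def s0_def by (simp_all add: minus_div_mult_eq_mod)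
        then have "s - s0 = \<gamma> * (x - x0) - ((\<gamma> * x) div int N - (\<gamma> * x0) div int N) * int N"
          by (simp add: algebra_simps)
        then show "\<exists>k. \<bar>real_of_int (\<gamma> * (x - x0) - k * int N)\<bar> \<le> 1 / real q * real N"
          using 1 by (intro exI) (simp only:)
      qed
      then have "(x - x0) mod int N \<in> bohr \<Gamma> (1 / real q)"
        using periodic_bohr by (simp add: periodic_def)
      then show "(x - x0) mod int N \<in> reps (bohr \<Gamma> (1 / real q))"
        using N_pos by (simp add: reps_def)
    qed
  qed simp
  then have "card ?F * q ^ card \<Gamma> \<le> card (reps (bohr \<Gamma> (1 / real q))) * q ^ card \<Gamma>"
    by (rule mult_right_mono) simp
  moreover have "N \<le> card ?F * q ^ card \<Gamma>" using y unfolding cardB by simp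
  ultimately show ?thesis by (rule order_trans[rotated])
qed

text \<open>A point entering the set under a shift lies in the larger Bohr set but not in the
  smaller one. Points that leave become, after translation, points that enter under the opposite
  shift; this explains the factor 2.\<close>

lemma regular_imp_almost_invariant:
  assumes "real (card (reps (bohr \<Gamma> (\<rho> + \<eta>)))) \<le> (1 + \<delta>) * real (card (reps (bohr \<Gamma> \<rho>)))" "0 \<le> \<eta>"
  shows "almost_invariant (2 * \<delta>) (bohr \<Gamma> \<rho>) (bohr \<Gamma> \<eta>)"
  unfolding almost_invariant_def
proof
  fix t assume t: "t \<in> bohr \<Gamma> \<eta>"
  let ?G = "{0..<int N}" and ?B = "bohr \<Gamma> \<rho>" and ?C = "bohr \<Gamma> (\<rho> + \<eta>)"
  have sub: "?B \<subseteq> ?C" using assms(2) by (intro bohr_mono) auto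
  have "card (reps ?C - reps ?B) = card (reps ?C) - card (reps ?B)"
    using sub by (intro card_Diff_subset) (auto simp: reps_def)
  then have diff: "real (card (reps ?C - reps ?B)) \<le> \<delta> * real (card (reps ?B))"
    using assms(1) card_mono[of "reps ?C" "reps ?B"] sub
    by (auto simp: algebra_simps of_nat_diff reps_def Int_mono le_infI1)
  have bound: "real (card {x\<in>?G. x + u \<in> ?B \<and> x \<notin> ?B}) \<le> \<delta> * real (card (reps ?B))" if "u \<in> bohr \<Gamma> \<eta>" for u
  proof -
    have "{x\<in>?G. x + u \<in> ?B \<and> x \<notin> ?B} \<subseteq> reps ?C - reps ?B"
    proof
      fix x assume x: "x \<in> {x\<in>?G. x + u \<in> ?B \<and> x \<notin> ?B}"
      then have "(x + u) + - u \<in> ?C" using that by (intro bohr_add bohr_minus) auto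
      then show "x \<in> reps ?C - reps ?B" using x by (simp add: reps_def)
    qed
    then have "card {x\<in>?G. x + u \<in> ?B \<and> x \<notin> ?B} \<le> card (reps ?C - reps ?B)"
      by (intro card_mono) auto
    then show ?thesis using diff by linarith
  qed
  have fin: "finite {x\<in>?G. P x}" for P by (rule finite_subset[of _ ?G]) auto
  have card_sum: "real (card {x\<in>?G. P x}) = (\<Sum>x\<in>?G. of_bool (P x))" for P
    by (simp add: Int_def)
  have "periodic (\<lambda>x. of_bool (x \<in> ?B \<and> x - t \<notin> ?B) :: real)"
    using periodic_combine[OF periodic_bohr periodic_comp(4)[OF periodic_bohr], of "\<lambda>b b'. of_bool (b \<and> \<not> b')"] .
  from sum_shift[OF this, of t]
  have "real (card {x\<in>?G. x \<in> ?B \<and> x - t \<notin> ?B}) = real (card {x\<in>?G. x + t \<in> ?B \<and> x \<notin> ?B})"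
    unfolding card_sum by simp
  moreover have "{x\<in>?G. (x - t \<in> ?B) \<noteq> (x \<in> ?B)}
      \<subseteq> {x\<in>?G. x + - t \<in> ?B \<and> x \<notin> ?B} \<union> {x\<in>?G. x \<in> ?B \<and> x - t \<notin> ?B}"
    by auto
  then have "card {x\<in>?G. (x - t \<in> ?B) \<noteq> (x \<in> ?B)}
      \<le> card {x\<in>?G. x + - t \<in> ?B \<and> x \<notin> ?B} + card {x\<in>?G. x \<in> ?B \<and> x - t \<notin> ?B}"
    by (rule order_trans[OF card_mono card_Un_le, rotated]) (simp only: finite_Un fin simp_thms)
  ultimately show "real (card {x\<in>?G. (x - t \<in> ?B) \<noteq> (x \<in> ?B)}) \<le> 2 * \<delta> * real (card (reps ?B))"
    using bound[OF t] bound[OF bohr_minus[OF t]] by linarith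
qed

text \<open>If every radius \<open>R j\<close> with \<open>j < J\<close> failed, the size would grow
  by a factor above \<open>(1 + 1 / e) ^ J \<ge> 2 ^ (L * D)\<close> between \<open>R 0\<close> and
  \<open>R J\<close>. But by \<open>card_bohr\<close> the set of radius \<open>R 0\<close> already
  has at least \<open>N / 2 ^ (L * D)\<close> points.\<close>

lemma regular_bohr:
  assumes \<Gamma>: "finite \<Gamma>" "card \<Gamma> \<le> D" and pos: "0 < D" "0 < L" "0 < e"
  shows "\<exists>\<rho>. 1 / 2 ^ L \<le> \<rho> \<and> \<rho> \<le> 2 / 2 ^ L \<and>
    almost_invariant (2 / real e) (bohr \<Gamma> \<rho>) (bohr \<Gamma> (1 / (2 ^ L * real (e * D * L))))"
proof -
  \<comment> \<open>By Bernoulli, \<open>e\<close> failing radii double the size, and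
    \<open>D * L\<close> doublings are enough.\<close>
  define J where "J = e * D * L"
  define \<eta> where "\<eta> = 1 / (2 ^ L * real J)"
  define c where "c \<rho> = real (card (reps (bohr \<Gamma> \<rho>)))" for \<rho>
  define R where "R j = 1 / 2 ^ L + real j * \<eta>" for j
  have J0: "J > 0" using pos by (simp add: J_def)
  have "\<exists>j<J. c (R (Suc j)) \<le> (1 + 1 / real e) * c (R j)"
  proof (rule ccontr)
    assume "\<not> ?thesis"
    then have step: "(1 + 1 / real e) * c (R j) < c (R (Suc j))" if "j < J" for j
      using that by (auto simp: not_le)
    have "c (R 0) \<ge> 0" by (simp add: c_def)
    \<comment> \<open>Strictness, hence \<open>0 < j\<close>, matters: the final chain compares
      \<open>2 ^ (L * D) * c (R 0)\<close> with itself.\<close>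
    have grow: "j \<le> J \<Longrightarrow> 0 < j \<Longrightarrow> (1 + 1 / real e) ^ j * c (R 0) < c (R j)" for j
    proof (induction j)
      case (Suc j)
      have "(1 + 1 / real e) ^ j * c (R 0) \<le> c (R j)"
        using Suc by (cases "j = 0") auto
      then have "(1 + 1 / real e) * ((1 + 1 / real e) ^ j * c (R 0)) \<le> (1 + 1 / real e) * c (R j)"
        by (intro mult_left_mono) auto
      then show ?case using step[of j] Suc.prems by simp
    qed simp
    have "2 \<le> (1 + 1 / real e) ^ e"
    proof -
      have "1 + real e * (1 / real e) \<le> (1 + 1 / real e) ^ e"
        by (rule Bernoulli_inequality) (rule order_trans[of _ 0], simp_all)
      then show ?thesis using pos(3) by simp
    qed
    then have "2 ^ (L * D) \<le> ((1 + 1 / real e) ^ e) ^ (L * D)"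
      by (intro power_mono) auto
    also have "\<dots> = (1 + 1 / real e) ^ J"
      by (simp add: J_def mult_ac flip: power_mult)
    finally have "2 ^ (L * D) * c (R 0) \<le> (1 + 1 / real e) ^ J * c (R 0)"
      using \<open>c (R 0) \<ge> 0\<close> by (intro mult_right_mono)
    also have "\<dots> < c (R J)" using grow[of J] J0 by simp
    also have "c (R J) \<le> real (card {0..<int N})"
      unfolding c_def of_nat_le_iff by (intro card_mono) (auto simp: reps_def)
    also have "\<dots> = real N" by simp
    also have "\<dots> \<le> real (card (reps (bohr \<Gamma> (1 / real (2 ^ L)))) * (2 ^ L) ^ card \<Gamma>)"
      using card_bohr[OF \<Gamma>(1), of "2 ^ L"] by (simp only: of_nat_le_iff) simp
    also have "\<dots> = c (R 0) * 2 ^ (L * card \<Gamma>)"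
      by (simp add: c_def R_def power_mult)
    also have "\<dots> \<le> c (R 0) * 2 ^ (L * D)"
      using \<Gamma>(2) \<open>c (R 0) \<ge> 0\<close> by (intro mult_left_mono power_increasing) auto
    finally show False by simp
  qed
  then obtain j where j: "j < J" "c (R j + \<eta>) \<le> (1 + 1 / real e) * c (R j)"
    by (auto simp: R_def algebra_simps)
  have \<eta>0: "\<eta> \<ge> 0" by (simp add: \<eta>_def)
  have "almost_invariant (2 * (1 / real e)) (bohr \<Gamma> (R j)) (bohr \<Gamma> \<eta>)"
    by (rule regular_imp_almost_invariant) (use j \<eta>0 in \<open>simp_all add: c_def\<close>)
  moreover have "real j * \<eta> \<le> real J * \<eta>"
    using j \<eta>0 by (intro mult_right_mono) auto
  then have "R j \<le> 2 / 2 ^ L"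
    using J0 by (simp add: R_def \<eta>_def)
  moreover have "1 / 2 ^ L \<le> R j" using \<eta>0 by (simp add: R_def)
  ultimately show ?thesis
    by (intro exI[of _ "R j"]) (simp add: \<eta>_def J_def)
qed

text \<open>Closing the frequency set under only boundedly many multiplications by \<open>a\<close> keeps the rank
  polynomial over the whole iteration; closing it under one multiplication after each
  increment would double the rank every time.\<close>

definition orbit :: "nat \<Rightarrow> int set \<Rightarrow> nat \<Rightarrow> int set" where
  "orbit a \<Theta> m = (\<lambda>(\<theta>, j). \<theta> * int a ^ j) ` (\<Theta> \<times> {..m})"

text \<open>A regular Bohr set at level \<open>L\<close> with its exact radius forgotten. One level
  down means \<open>\<mu>\<close> more halvings; the constant 4 makes room for a sum of two elements
  of sets lying at level \<open>L + \<mu>\<close> or deeper.\<close>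

definition bohr_like :: "real \<Rightarrow> nat \<Rightarrow> int set \<Rightarrow> nat \<Rightarrow> int set \<Rightarrow> bool" where
  "bohr_like \<epsilon> \<mu> \<Gamma> L B \<longleftrightarrow> periodic (\<lambda>x. x \<in> B) \<and> bohr \<Gamma> (1 / 2 ^ L) \<subseteq> B \<and> B \<subseteq> bohr \<Gamma> (2 / 2 ^ L) \<and>
     almost_invariant \<epsilon> B (bohr \<Gamma> (4 / 2 ^ (L + \<mu>)))"

lemma almost_invariant_subset: "almost_invariant \<epsilon> B U \<Longrightarrow> U' \<subseteq> U \<Longrightarrow> almost_invariant \<epsilon> B U'"
  unfolding almost_invariant_def by blast

lemma bohr_like_nonempty: 
  assumes "bohr_like \<epsilon> \<mu> \<Gamma> L B" shows "reps B \<noteq> {}"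
proof -
  have "0 \<in> B" using assms zero_in_bohr[of "1 / 2 ^ L" \<Gamma>] by (auto simp: bohr_like_def)
  then show ?thesis using N_pos by (auto simp: reps_def)
qed

text \<open>The condition on \<mu> makes \<open>2 ^ \<mu>\<close> beat the denominator
  \<open>e * D * L\<close> of the regularity scale, so one \<mu> serves all ranks up to
  \<open>D\<close>.\<close>

lemma exists_bohr_like:
  assumes "finite \<Gamma>" "card \<Gamma> \<le> D" "0 < D" "0 < L" "0 < e" "4 * e * D * L \<le> 2 ^ \<mu>"
  shows "\<exists>B. bohr_like (2 / real e) \<mu> \<Gamma> L B"
proof -
  obtain \<rho> where \<rho>: "1 / 2 ^ L \<le> \<rho>" "\<rho> \<le> 2 / 2 ^ L"
    "almost_invariant (2 / real e) (bohr \<Gamma> \<rho>) (bohr \<Gamma> (1 / (2 ^ L * real (e * D * L))))"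
    using regular_bohr assms by blast
  have "real (4 * (e * D * L)) \<le> real (2 ^ \<mu>)"
    using assms(6) unfolding of_nat_le_iff by (simp add: mult.assoc)
  then have "4 * real (e * D * L) \<le> 2 ^ \<mu>" by simp
  moreover have "real (e * D * L) > 0" using assms by simp
  ultimately have "4 / 2 ^ (L + \<mu>) \<le> 1 / (2 ^ L * real (e * D * L))"
    by (simp add: power_add divide_simps del: of_nat_mult)
  then have "bohr \<Gamma> (4 / 2 ^ (L + \<mu>)) \<subseteq> bohr \<Gamma> (1 / (2 ^ L * real (e * D * L)))"
    by (intro bohr_mono) auto
  then have "almost_invariant (2 / real e) (bohr \<Gamma> \<rho>) (bohr \<Gamma> (4 / 2 ^ (L + \<mu>)))"
    by (rule almost_invariant_subset[OF \<rho>(3)])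
  then have "bohr_like (2 / real e) \<mu> \<Gamma> L (bohr \<Gamma> \<rho>)"
    using \<rho>(1,2) periodic_bohr unfolding bohr_like_def by (simp add: bohr_mono)
  then show ?thesis by blast
qed

text \<open>The largeness of \<open>N\<close> enters here: a Bohr set reduced to one residue would
  force \<open>N \<le> 2 ^ (L' * D)\<close>.\<close>

lemma bohr_like_large:
  assumes "bohr_like \<epsilon> \<mu> \<Gamma> L B" "finite \<Gamma>" "card \<Gamma> \<le> D" "L \<le> L'" "2 ^ (L' * D) < N"
  shows "2 \<le> card (reps B)"
proof (rule ccontr)
  assume neg: "\<not> ?thesis"
  have "card (reps (bohr \<Gamma> (1 / 2 ^ L))) \<le> card (reps B)"
    using assms(1) by (intro card_mono) (auto simp: bohr_like_def reps_def)
  also have "\<dots> \<le> 1" using neg by simp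
  finally have "N \<le> 1 * (2 ^ L) ^ card \<Gamma>"
    using card_bohr[OF assms(2), of "2 ^ L"] by (auto intro: order_trans mult_right_mono)
  also have "\<dots> = 2 ^ (L * card \<Gamma>)" by (simp add: power_mult)
  also have "\<dots> \<le> 2 ^ (L' * D)"
    using assms by (intro power_increasing mult_le_mono) auto
  finally show False using assms by simp
qed

end

subsection \<open>Iterating the increment\<close>

locale sum_free_cover = modulus +
  fixes a r :: nat and A :: "nat \<Rightarrow> int set"
  assumes r_pos: "0 < r"
    and periodic_A: "periodic (\<lambda>x. x \<in> A i)"
    and no_solution: "x \<in> A i \<Longrightarrow> y \<in> A i \<Longrightarrow> x + int a * y \<notin> A i"
    and cover: "\<not> int N dvd x \<Longrightarrow> \<exists>i\<in>{1..r}. x \<in> A i"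
begin

text \<open>Zero may be uncoloured, but it makes up at most half of a set with two or more residues.
  The other half is shared among \<open>r\<close> classes.\<close>

lemma dense_class:
  assumes "2 \<le> card (reps W)"
  shows "\<exists>i\<in>{1..r}. 1 / (2 * real r) * real (card (reps W)) \<le> real (card (reps (A i \<inter> W)))"
proof (rule ccontr)
  assume neg: "\<not> ?thesis"
  have "reps W \<subseteq> {0} \<union> (\<Union>i\<in>{1..r}. reps (A i \<inter> W))"
  proof
    fix x assume x: "x \<in> reps W"
    show "x \<in> {0} \<union> (\<Union>i\<in>{1..r}. reps (A i \<inter> W))"
    proof (cases "x = 0")
      case False
      then have "\<not> int N dvd x" using x by (auto simp: reps_def dest: zdvd_imp_le)
      then show ?thesis using cover x by (fastforce simp: reps_def)
    qed simp
  qed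
  then have "card (reps W) \<le> card ({0::int} \<union> (\<Union>i\<in>{1..r}. reps (A i \<inter> W)))"
    by (intro card_mono) auto
  also have "\<dots> \<le> card {0::int} + card (\<Union>i\<in>{1..r}. reps (A i \<inter> W))" by (rule card_Un_le)
  also have "\<dots> \<le> 1 + (\<Sum>i\<in>{1..r}. card (reps (A i \<inter> W)))"
    using card_UN_le[of "{1..r}" "\<lambda>i. reps (A i \<inter> W)"] by simp
  finally have "real (card (reps W)) \<le> 1 + (\<Sum>i\<in>{1..r}. real (card (reps (A i \<inter> W))))"
    by (simp flip: of_nat_sum of_nat_Suc)
  also have "(\<Sum>i\<in>{1..r}. real (card (reps (A i \<inter> W)))) < (\<Sum>i\<in>{1..r}. 1 / (2 * real r) * real (card (reps W)))"
    using neg r_pos by (intro sum_strict_mono) (auto simp: not_le)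
  also have "\<dots> = real (card (reps W)) / 2" using r_pos by simp
  finally show False using assms by simp
qed

text \<open>The potential of the iteration: it never exceeds \<open>r\<close>, yet every step raises
  it by a fixed power of \<open>1 / (2 * r)\<close>.\<close>

definition energy :: "int set \<Rightarrow> real" where
  "energy B = (\<Sum>i\<in>{1..r}. max_density (A i) a B)"

lemma energy_le: "energy B \<le> real r"
  unfolding energy_def using sum_mono[of "{1..r}" "\<lambda>i. max_density (A i) a B" "\<lambda>_. 1"] max_density_le_1 by simp

text \<open>A class dense on \<open>W\<close> gains \<open>\<tau> ^ 15\<close>: through a new
  frequency if its maximal density on \<open>Y\<close> is at least \<open>\<tau> / 2\<close>, and by
  dilation otherwise. Every other class loses at most \<epsilon>, and \<open>r * \<epsilon>\<close>
  is far smaller than the gain.\<close>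

lemma energy_increment:
  fixes \<tau> \<epsilon> :: real
  defines "\<tau> \<equiv> 1 / (2 * real r)" and "\<epsilon> \<equiv> (1 / (2 * real r)) ^ 20"
  assumes \<Theta>: "7 * (2 / 2 ^ \<mu>) \<le> \<epsilon>"
    and Y: "bohr_like \<epsilon> \<mu> (orbit a \<Theta> m) L Y"
    and W: "bohr_like \<epsilon> \<mu> (orbit a \<Theta> m) (L + \<mu>) W" "2 \<le> card (reps W)"
    and V: "bohr_like \<epsilon> \<mu> (orbit a \<Theta> m) (L + 2 * \<mu>) V"
  shows "\<exists>\<theta>. \<forall>Z. bohr_like \<epsilon> \<mu> (orbit a (insert \<theta> \<Theta>) (Suc m)) (L + 3 * \<mu>) Z \<longrightarrow> energy Y + \<tau> ^ 16 \<le> energy Z"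
proof -
  let ?\<Gamma> = "orbit a \<Theta> m"
  have \<tau>: "0 < \<tau>" "\<tau> \<le> 1 / 2" using r_pos by (simp_all add: \<tau>_def divide_simps)
  have \<epsilon>: "\<epsilon> = \<tau> ^ 20" by (simp add: \<epsilon>_def \<tau>_def)
  have mu_ge: "7 * (2 / 2 ^ (n + \<mu>)) \<le> \<epsilon>" for n
  proof -
    have "(2::real) ^ \<mu> \<le> 2 ^ (n + \<mu>)" by (intro power_increasing) auto
    then have "7 * (2 / 2 ^ (n + \<mu>)) \<le> (7 * (2 / 2 ^ \<mu>) :: real)"
      by (intro mult_left_mono divide_left_mono) auto
    then show ?thesis using \<Theta> by linarith
  qed
  have per: "periodic (\<lambda>x. x \<in> Y)" "periodic (\<lambda>x. x \<in> W)" "periodic (\<lambda>x. x \<in> V)"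
    using Y W V by (simp_all add: bohr_like_def)
  have ne: "reps Y \<noteq> {}" "reps W \<noteq> {}" "reps V \<noteq> {}"
    using bohr_like_nonempty Y W V by blast+
  \<comment> \<open>The extra power of \<open>a\<close> in the orbit puts \<open>a Z\<close> into a
    Bohr set of the old frequencies, and the new frequency makes its character nearly 1 on
    \<open>Z\<close>.\<close>
  have small: "Z \<subseteq> bohr ?\<Gamma> (2 / 2 ^ (L + 3 * \<mu>)) \<and> (\<lambda>z. int a * z) ` Z \<subseteq> bohr ?\<Gamma> (2 / 2 ^ (L + 3 * \<mu>)) \<and>
      (\<forall>u\<in>Z. cmod (additive_char (\<theta> * u) - 1) \<le> \<epsilon>)"
    if "bohr_like \<epsilon> \<mu> (orbit a (insert \<theta> \<Theta>) (Suc m)) (L + 3 * \<mu>) Z" for Z \<theta>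
  proof (intro conjI ballI)
    let ?\<Gamma>' = "orbit a (insert \<theta> \<Theta>) (Suc m)"
    have Z: "Z \<subseteq> bohr ?\<Gamma>' (2 / 2 ^ (L + 3 * \<mu>))" using that by (simp add: bohr_like_def)
    have "?\<Gamma> \<subseteq> ?\<Gamma>'" unfolding orbit_def by (intro image_mono) auto
    then show "Z \<subseteq> bohr ?\<Gamma> (2 / 2 ^ (L + 3 * \<mu>))" using Z bohr_mono by blast
    have "\<gamma> * int a \<in> ?\<Gamma>'" if \<gamma>: "\<gamma> \<in> ?\<Gamma>" for \<gamma>
    proof -
      obtain t j where "t \<in> \<Theta>" "j \<le> m" "\<gamma> = t * int a ^ j" using \<gamma> by (auto simp: orbit_def)
      then show ?thesis unfolding orbit_def by (intro image_eqI[of _ _ "(t, Suc j)"]) auto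
    qed
    then show "(\<lambda>z. int a * z) ` Z \<subseteq> bohr ?\<Gamma> (2 / 2 ^ (L + 3 * \<mu>))"
      using Z bohr_dilate by blast
    have "\<theta> \<in> ?\<Gamma>'" unfolding orbit_def by (intro image_eqI[of _ _ "(\<theta>, 0)"]) auto
    then show "cmod (additive_char (\<theta> * u) - 1) \<le> \<epsilon>" if "u \<in> Z" for u
      using bohr_char[of u ?\<Gamma>' "2 / 2 ^ (L + 3 * \<mu>)" \<theta>] Z that mu_ge[of "L + 2 * \<mu>"]
      by (auto simp: add.assoc)
  qed
  have invY: "almost_invariant \<epsilon> Y (bohr ?\<Gamma> (4 / 2 ^ (L + \<mu>)))"
    and invW: "almost_invariant \<epsilon> W (bohr ?\<Gamma> (4 / 2 ^ (L + \<mu> + \<mu>)))"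
    and invV: "almost_invariant \<epsilon> V (bohr ?\<Gamma> (4 / 2 ^ (L + 2 * \<mu> + \<mu>)))"
    using Y W V by (simp_all add: bohr_like_def)
  have subW: "W \<subseteq> bohr ?\<Gamma> (2 / 2 ^ (L + \<mu>))" and subV: "V \<subseteq> bohr ?\<Gamma> (2 / 2 ^ (L + 2 * \<mu>))"
    using W V by (simp_all add: bohr_like_def)
  have radii: "(2::real) / 2 ^ (L + 3 * \<mu>) \<le> 4 / 2 ^ (L + 2 * \<mu> + \<mu>)" "(2::real) / 2 ^ (L + 3 * \<mu>) \<le> 4 / 2 ^ (L + \<mu> + \<mu>)"
    "(2::real) / 2 ^ (L + 3 * \<mu>) \<le> 4 / 2 ^ (L + \<mu>)" "(2::real) / 2 ^ (L + 2 * \<mu>) \<le> 4 / 2 ^ (L + \<mu> + \<mu>)"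
    "(2::real) / 2 ^ (L + 2 * \<mu>) \<le> 2 / 2 ^ (L + \<mu>)" "(2::real) / 2 ^ (L + 2 * \<mu>) \<le> 4 / 2 ^ (L + \<mu>)"
    by (intro frac_le power_increasing; simp)+
  have mono: "max_density (A i) a Y - \<epsilon> \<le> max_density (A i) a Z"
    if "bohr_like \<epsilon> \<mu> (orbit a (insert \<theta> \<Theta>) (Suc m)) (L + 3 * \<mu>) Z" for i Z \<theta>
  proof (rule max_density_mono[OF periodic_A _ per(1) bohr_like_nonempty[OF that] ne(1)])
    show "almost_invariant \<epsilon> Y Z"
      using small[OF that] radii(3) bohr_mono by (intro almost_invariant_subset[OF invY]) blast
  qed
  obtain i where i: "i \<in> {1..r}" "\<tau> * real (card (reps W)) \<le> real (card (reps (A i \<inter> W)))"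
    using dense_class[OF W(2)] unfolding \<tau>_def by blast
  have "\<exists>\<theta>. \<forall>Z. bohr_like \<epsilon> \<mu> (orbit a (insert \<theta> \<Theta>) (Suc m)) (L + 3 * \<mu>) Z \<longrightarrow>
      max_density (A i) a Y + \<tau> ^ 15 \<le> max_density (A i) a Z"
  proof (cases "\<tau> / 2 \<le> max_density (A i) a Y")
    case True
    have "almost_invariant \<epsilon> Y V" 
      using subV radii(6) bohr_mono by (intro almost_invariant_subset[OF invY]) blast
    moreover have "almost_invariant \<epsilon> Y {v + w |v w. v \<in> V \<and> w \<in> W}"
    proof (rule almost_invariant_subset[OF invY], safe)
      fix v w assume "v \<in> V" "w \<in> W"
      then have "v + w \<in> bohr ?\<Gamma> (2 / 2 ^ (L + 2 * \<mu>) + 2 / 2 ^ (L + \<mu>))"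
        using subV subW by (intro bohr_add) auto
      moreover have "(2::real) / 2 ^ (L + 2 * \<mu>) + 2 / 2 ^ (L + \<mu>) \<le> 4 / 2 ^ (L + \<mu>)"
        using radii(5) by simp
      ultimately show "v + w \<in> bohr ?\<Gamma> (4 / 2 ^ (L + \<mu>))"
        using bohr_mono by blast
    qed
    moreover have "almost_invariant \<epsilon> W V"
      using subV radii(4) bohr_mono by (intro almost_invariant_subset[OF invW]) blast
    ultimately obtain \<theta> where \<theta>: "\<And>Z. reps Z \<noteq> {} \<Longrightarrow> almost_invariant \<epsilon> V Z \<Longrightarrow>
        (\<forall>u\<in>Z. cmod (additive_char (\<theta> * u) - 1) \<le> \<epsilon>) \<Longrightarrow> max_density (A i) a Y + \<tau> ^ 15 \<le> max_density (A i) a Z"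
      using density_increment[OF \<tau> \<epsilon> periodic_A no_solution per ne _ _ _ i(2) True] by blast
    show ?thesis
    proof (intro exI allI impI)
      fix Z assume Z: "bohr_like \<epsilon> \<mu> (orbit a (insert \<theta> \<Theta>) (Suc m)) (L + 3 * \<mu>) Z"
      have "almost_invariant \<epsilon> V Z"
        using small[OF Z] radii(1) bohr_mono by (intro almost_invariant_subset[OF invV]) blast
      then show "max_density (A i) a Y + \<tau> ^ 15 \<le> max_density (A i) a Z"
        using small[OF Z] bohr_like_nonempty[OF Z] by (intro \<theta>) auto
    qed
  \<comment> \<open>The class is dense on \<open>W\<close> but sparse on \<open>Y\<close>, so the
    dilation argument applies for any frequency; 0 serves as the witness.\<close>
  next
    case False
    show ?thesis
    proof (intro exI allI impI)
      fix Z assume Z: "bohr_like \<epsilon> \<mu> (orbit a (insert 0 \<Theta>) (Suc m)) (L + 3 * \<mu>) Z"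
      have "almost_invariant \<epsilon> W ((\<lambda>z. int a * z) ` Z)"
        using small[OF Z] radii(2) bohr_mono by (intro almost_invariant_subset[OF invW]) blast
      then have "avg W (indicator (A i)) - \<epsilon> \<le> max_density (A i) a Z"
        by (intro max_density_dilate periodic_A per ne bohr_like_nonempty[OF Z])
      moreover have "\<tau> \<le> avg W (indicator (A i))"
      proof -
        have "(\<Sum>x\<in>reps W. indicator (A i) x) = real (card (reps (A i \<inter> W)))"
          by (simp add: indicator_def reps_def Int_ac)
        then show ?thesis
          using i(2) card_reps_pos[OF ne(2)] by (simp add: avg_def pos_le_divide_eq)
      qed
      moreover have "\<tau> ^ 15 + \<epsilon> \<le> \<tau> / 2"
      proof -
        have "\<tau> ^ 15 \<le> \<tau> ^ 3" "\<tau> ^ 20 \<le> \<tau> ^ 3" using \<tau> by (intro power_decreasing; simp)+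
        moreover have "\<tau> * (\<tau> * \<tau>) \<le> \<tau> * (1 / 4)"
          using mult_mono[OF \<tau>(2) \<tau>(2)] \<tau>(1) by (intro mult_left_mono) auto
        ultimately show ?thesis unfolding \<epsilon> power3_eq_cube by simp
      qed
      ultimately show "max_density (A i) a Y + \<tau> ^ 15 \<le> max_density (A i) a Z"
        using False by linarith
    qed
  qed
  then obtain \<theta> where \<theta>: "\<And>Z. bohr_like \<epsilon> \<mu> (orbit a (insert \<theta> \<Theta>) (Suc m)) (L + 3 * \<mu>) Z \<Longrightarrow>
      max_density (A i) a Y + \<tau> ^ 15 \<le> max_density (A i) a Z" by blast
  show ?thesis
  proof (intro exI allI impI)
    fix Z assume Z: "bohr_like \<epsilon> \<mu> (orbit a (insert \<theta> \<Theta>) (Suc m)) (L + 3 * \<mu>) Z"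
    have "(\<Sum>j\<in>{1..r}. (if j = i then \<tau> ^ 15 else 0) - \<epsilon>) \<le> (\<Sum>j\<in>{1..r}. max_density (A j) a Z - max_density (A j) a Y)"
    proof (rule sum_mono)
      fix j
      have "0 \<le> \<epsilon>" using \<tau> by (simp add: \<epsilon>)
      then show "(if j = i then \<tau> ^ 15 else 0) - \<epsilon> \<le> max_density (A j) a Z - max_density (A j) a Y"
        using \<theta>[OF Z] mono[OF Z, of j] by (cases "j = i") auto
    qed
    then have "\<tau> ^ 15 - real r * \<epsilon> \<le> energy Z - energy Y"
      using i(1) by (simp add: energy_def sum_subtractf)
    \<comment> \<open>As \<open>r * \<tau> = 1 / 2\<close>, the total loss
      \<open>r * \<epsilon>\<close> is \<open>\<tau> ^ 19 / 2\<close>.\<close>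
    moreover have "\<tau> ^ 16 + real r * \<epsilon> \<le> \<tau> ^ 15"
    proof -
      have "real r * \<epsilon> = (real r * \<tau>) * \<tau> ^ 19" by (simp add: \<epsilon> flip: power_Suc)
      also have "real r * \<tau> = 1 / 2" using r_pos by (simp add: \<tau>_def)
      also have "\<tau> ^ 19 \<le> \<tau> ^ 15" using \<tau> by (intro power_decreasing) auto
      finally have "real r * \<epsilon> \<le> \<tau> ^ 15 / 2" by simp
      moreover have "\<tau> ^ 16 \<le> \<tau> ^ 15 / 2"
        using mult_right_mono[OF \<tau>(2), of "\<tau> ^ 15"] \<tau>(1) by (simp flip: power_Suc)
      ultimately show ?thesis by linarith
    qed
    ultimately show "energy Y + \<tau> ^ 16 \<le> energy Z" by linarith
  qed
qed

section \<open>The iteration and the choice of parameters\<close>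

lemma energy_nonneg: "0 \<le> energy B"
proof -
  have "0 \<le> max_density (A i) a B" for i
  proof -
    obtain x where "max_density (A i) a B = avg B (\<lambda>b. indicator (A i) (x + int a * b))"
      using max_density_attained by blast
    then show ?thesis by (simp add: avg_def sum_nonneg)
  qed
  then show ?thesis by (simp add: energy_def sum_nonneg)
qed

lemma finite_orbit: "finite \<Theta> \<Longrightarrow> finite (orbit a \<Theta> m)"
  by (simp add: orbit_def)

lemma card_orbit: "finite \<Theta> \<Longrightarrow> card (orbit a \<Theta> m) \<le> card \<Theta> * Suc m"
  unfolding orbit_def
  by (rule order_trans[OF card_image_le]) (simp_all add: card_cartesian_product)

text \<open>All parameters are fixed in advance: \<open>D\<close> bounds the rank at every stage (at
  most \<open>T\<close> frequencies, \<open>T + 1\<close> powers of \<open>a\<close>),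
  \<open>L'\<close> bounds every level, and stage \<open>k\<close> sits at level
  \<open>\<mu> * (3 * k + 1)\<close> since each step descends three levels for \<open>W\<close>,
  \<open>V\<close> and the next set.\<close>

lemma iterated_increment:
  fixes e D \<mu> T L' k :: nat
  assumes e: "e = 2 * (2 * r) ^ 20" and D: "T * Suc T \<le> D" "0 < D" and \<mu>: "0 < \<mu>"
    and L': "L' = \<mu> * (3 * T + 4)" "4 * e * D * L' \<le> 2 ^ \<mu>" "2 ^ (L' * D) < N" and k: "k \<le> T"
  shows "\<exists>\<Theta> Y. finite \<Theta> \<and> card \<Theta> \<le> k \<and>
    bohr_like ((1 / (2 * real r)) ^ 20) \<mu> (orbit a \<Theta> k) (\<mu> * (3 * k + 1)) Y \<and>
    real k * (1 / (2 * real r)) ^ 16 \<le> energy Y"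
  using k
proof (induction k)
  define \<epsilon> :: real where "\<epsilon> = (1 / (2 * real r)) ^ 20"
  have \<epsilon>: "2 / real e = \<epsilon>" by (simp add: e \<epsilon>_def power_divide)
  have e0: "0 < e" using r_pos by (simp add: e)
  have ex: "\<exists>B. bohr_like \<epsilon> \<mu> (orbit a \<Theta> k) L B" and card_D: "card (orbit a \<Theta> k) \<le> D"
    if "finite \<Theta>" "card \<Theta> \<le> k" "k \<le> T" "0 < L" "L \<le> L'" for \<Theta> k L
  proof -
    have "card (orbit a \<Theta> k) \<le> T * Suc T"
      using card_orbit[OF that(1), of k] mult_le_mono[of "card \<Theta>" T "Suc k" "Suc T"] that by simp
    then show "card (orbit a \<Theta> k) \<le> D" using D by simp
    moreover have "4 * e * D * L \<le> 2 ^ \<mu>"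
      using L'(2) that(5) by (meson mult_le_mono2 order_trans)
    ultimately show "\<exists>B. bohr_like \<epsilon> \<mu> (orbit a \<Theta> k) L B"
      using exists_bohr_like[of "orbit a \<Theta> k" D L e \<mu>] finite_orbit[OF that(1)] D e0 that(4)
      by (simp add: \<epsilon>)
  qed
  note \<epsilon>_def[symmetric, simp]
  {
    case 0
    have "\<mu> * (3 * 0 + 1) \<le> L'" "0 < \<mu> * (3 * 0 + 1)" using \<mu> by (simp_all add: L'(1))
    then obtain B where "bohr_like \<epsilon> \<mu> (orbit a {} 0) (\<mu> * (3 * 0 + 1)) B"
      using ex[of "{}" 0] by auto
    then show ?case
      using energy_nonneg by (intro exI[of _ "{}"] exI[of _ B]) simp
  next
    case (Suc k)
    define L where "L = \<mu> * (3 * k + 1)"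
    from Suc obtain \<Theta> Y where IH: "finite \<Theta>" "card \<Theta> \<le> k" "bohr_like \<epsilon> \<mu> (orbit a \<Theta> k) L Y"
      "real k * (1 / (2 * real r)) ^ 16 \<le> energy Y"
      by (auto simp: L_def)
    have L: "L + 3 * \<mu> \<le> L'" "0 < L"
    proof -
      have "L + 3 * \<mu> = \<mu> * (3 * k + 4)" by (simp add: L_def algebra_simps)
      then show "L + 3 * \<mu> \<le> L'" using Suc.prems by (simp add: L'(1))
    qed (use \<mu> in \<open>simp add: L_def\<close>)
    have kT: "k \<le> T" using Suc.prems by simp
    obtain W where W: "bohr_like \<epsilon> \<mu> (orbit a \<Theta> k) (L + \<mu>) W"
      using ex[OF IH(1,2) kT, of "L + \<mu>"] L by auto
    obtain V where V: "bohr_like \<epsilon> \<mu> (orbit a \<Theta> k) (L + 2 * \<mu>) V"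
      using ex[OF IH(1,2) kT, of "L + 2 * \<mu>"] L by auto
    have W2: "2 \<le> card (reps W)"
      using L by (intro bohr_like_large[OF W finite_orbit[OF IH(1)] card_D[OF IH(1,2) kT L(2)] _ L'(3)]) auto
    \<comment> \<open>This amounts to \<open>7 * e \<le> 2 ^ \<mu>\<close>, which follows from the
      condition on \<open>L'\<close> because \<open>D * L' \<ge> 2\<close>.\<close>
    have "7 * (2 / 2 ^ \<mu>) \<le> \<epsilon>"
    proof -
      have "1 * 4 \<le> L'"
        using \<mu> unfolding L'(1) by (intro mult_le_mono) auto
      then have "1 * 4 \<le> D * L'"
        using D by (intro mult_le_mono) auto
      then have "2 \<le> D * L'" by linarith
      then have "4 * e * 2 \<le> 4 * e * (D * L')" by (intro mult_le_mono2)
      also have "\<dots> \<le> 2 ^ \<mu>" using L'(2) by (simp add: mult.assoc)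
      finally have "real (7 * e) \<le> real (2 ^ \<mu>)" unfolding of_nat_le_iff by simp
      then have "7 * real e \<le> 2 ^ \<mu>" by simp
      then show ?thesis unfolding \<epsilon>[symmetric] using e0 by (simp add: divide_simps)
    qed
    then obtain \<theta> where \<theta>: "\<And>Z. bohr_like \<epsilon> \<mu> (orbit a (insert \<theta> \<Theta>) (Suc k)) (L + 3 * \<mu>) Z
        \<Longrightarrow> energy Y + (1 / (2 * real r)) ^ 16 \<le> energy Z"
      using energy_increment[of \<mu> \<Theta> k L Y W V] IH(3) W W2 V unfolding \<epsilon>_def by blast
    have ins: "finite (insert \<theta> \<Theta>)" "card (insert \<theta> \<Theta>) \<le> Suc k"
      using IH(1,2) by (auto simp: card_insert_if)
    obtain Z where Z: "bohr_like \<epsilon> \<mu> (orbit a (insert \<theta> \<Theta>) (Suc k)) (L + 3 * \<mu>) Z"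
      using ex[OF ins Suc.prems, of "L + 3 * \<mu>"] L by auto
    moreover have "real (Suc k) * (1 / (2 * real r)) ^ 16 \<le> energy Z"
      using \<theta>[OF Z] IH(4) by (simp add: distrib_right)
    moreover have "L + 3 * \<mu> = \<mu> * (3 * Suc k + 1)" by (simp add: L_def algebra_simps)
    ultimately show ?case
      using ins by (intro exI[of _ "insert \<theta> \<Theta>"] exI[of _ Z]) (simp only: \<epsilon>_def)
  }
qed

text \<open>With \<open>s = 2 * r\<close>, running \<open>s ^ 18\<close> steps would raise the
  energy to \<open>s ^ 2 > r\<close>. Hence \<open>N\<close> cannot be large enough to run them, so
  \<open>N \<le> 2 ^ (L' * D)\<close>, and the exponents 111 and 37 of the bounds for
  \<open>L'\<close> and \<open>D\<close> add up to 148.\<close>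

lemma modulus_bound: "real N \<le> exp ((2 * real r) ^ 148)"
proof -
  define s where "s = 2 * r"
  have s: "2 \<le> s" using r_pos by (simp add: s_def)
  have pow: "2 ^ i * s ^ j \<le> s ^ (i + j)" for i j
    using s by (simp add: power_add power_mono)
  \<comment> \<open>The value of \<open>D\<close> dominates \<open>T * (T + 1)\<close>. The value of
    \<mu> is generous, so that \<open>2 ^ \<mu>\<close> exceeds \<open>s ^ 178\<close> and thus
    \<open>4 * e * D * L'\<close>, although \<open>L'\<close> itself contains \<mu>.\<close>
  define T D \<mu> e where "T = s ^ 18" and "D = s ^ 37" and "\<mu> = s ^ 90" and "e = 2 * s ^ 20"
  define L' where "L' = \<mu> * (3 * T + 4)"
  have one: "1 \<le> s ^ j" for j using s by simp
  have T: "Suc T \<le> s ^ 19" "3 * T + 4 \<le> s ^ 21"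
    using pow[of 1 18] pow[of 3 18] one[of 18] by (simp_all add: T_def)
  have "T * Suc T \<le> s ^ 18 * s ^ 19" unfolding T_def[symmetric] by (intro mult_le_mono2 T)
  then have TD: "T * Suc T \<le> D" unfolding D_def by (simp flip: power_add)
  have L': "L' \<le> s ^ 111"
    using mult_le_mono2[OF T(2), of \<mu>] unfolding L'_def \<mu>_def by (simp flip: power_add)
  have "4 * e * D * L' \<le> s ^ 2 * s ^ 21 * s ^ 37 * s ^ 111"
    unfolding D_def using pow[of 1 20] power_mono[OF s, of 2] by (intro mult_le_mono L') (simp_all add: e_def)
  also have "\<dots> = s ^ 171" by (simp flip: power_add)
  also have "\<dots> \<le> s ^ 178" using s by (intro power_increasing) auto
  also have "\<dots> = (s ^ 89) ^ 2" by (simp flip: power_mult)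
  also have "\<dots> \<le> (2 ^ (s ^ 89)) ^ 2" by (rule power_mono[OF less_imp_le[OF less_exp]]) simp
  also have "\<dots> = 2 ^ (s ^ 89 * 2)" by (rule power_mult[symmetric])
  also have "\<dots> \<le> 2 ^ \<mu>"
    using pow[of 1 89] by (intro power_increasing) (simp_all add: \<mu>_def mult.commute)
  finally have gap: "4 * e * D * L' \<le> 2 ^ \<mu>" .
  have "N \<le> 2 ^ (L' * D)"
  proof (rule ccontr)
    assume "\<not> ?thesis"
    then have "2 ^ (L' * D) < N" by simp
    then obtain Y where "real T * (1 / (2 * real r)) ^ 16 \<le> energy Y"
      using iterated_increment[OF _ TD _ _ L'_def gap _ order_refl] s
      by (auto simp: e_def s_def D_def \<mu>_def)
    then have "real T * (1 / (2 * real r)) ^ 16 \<le> real r" using energy_le order_trans by blast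
    moreover have "real T * (1 / (2 * real r)) ^ 16 = real s ^ 2"
    proof -
      have "real T = real s ^ 2 * real s ^ 16" by (simp add: T_def flip: power_add)
      moreover have "2 * real r = real s" by (simp add: s_def)
      ultimately have "real T * (1 / (2 * real r)) ^ 16 = real s ^ 2 * (real s * (1 / real s)) ^ 16"
        by (simp only: power_mult_distrib mult.assoc)
      then show ?thesis using s by simp
    qed
    ultimately have "real s ^ 2 \<le> real s / 2" by (simp add: s_def)
    moreover have "real s * 1 \<le> real s * real s" using s by (intro mult_left_mono) auto
    ultimately show False using s by (simp add: power2_eq_square)
  qed
  then have "real N \<le> real (2 ^ (L' * D))" by (simp only: of_nat_le_iff)
  also have "\<dots> \<le> exp 1 ^ (L' * D)"
    using exp_ge_add_one_self[of 1] by (simp add: power_mono)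
  also have "\<dots> = exp (real (L' * D))" by (metis exp_of_nat_mult mult.right_neutral)
  also have "\<dots> \<le> exp (real (s ^ 148))"
  proof -
    have "L' * D \<le> s ^ 111 * s ^ 37" unfolding D_def by (intro mult_le_mono L') simp
    then show ?thesis by (simp only: exp_le_cancel_iff of_nat_le_iff power_add[symmetric]) simp
  qed
  finally show ?thesis by (simp add: s_def)
qed

end

section \<open>From colourings to periodic classes\<close>

theorem theorem1p4:
  "\<exists>C::real. C > 0 \<and>
     (\<forall>(a::nat) (N::nat) (r::nat) (c :: int \<Rightarrow> nat).
        N > 0 \<longrightarrow> coprime a N \<longrightarrow>
        is_colouring r (nonzero_residues N) c \<longrightarrow>
        \<not> (\<exists>x1 x2 x3. monochromatic_solution a N c x1 x2 x3) \<longrightarrow>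
        real N \<le> exp ((2 * real r) powr C))"
proof (intro exI[of _ 148] conjI allI impI)
  fix a N r :: nat and c :: "int \<Rightarrow> nat"
  assume N: "N > 0" and col: "is_colouring r (nonzero_residues N) c"
    and none: "\<not> (\<exists>x1 x2 x3. monochromatic_solution a N c x1 x2 x3)"
  show "real N \<le> exp ((2 * real r) powr 148)"
  proof (cases "r = 0")
    case True
    \<comment> \<open>Without colours there is no non-zero residue, so \<open>N = 1\<close>; the
      bound then holds because \<open>0 powr 148 = 0\<close> and \<open>exp 0 = 1\<close>.\<close>
    then have "nonzero_residues N = {}" using col by (auto simp: is_colouring_def)
    then show ?thesis using N True by (simp add: nonzero_residues_def)
  next
    case False
    define A where "A i = {x. \<not> int N dvd x \<and> c (x mod int N) = i}" for i
    have nz: "x mod int N \<in> nonzero_residues N" if "\<not> int N dvd x" for x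
    proof -
      have "x mod int N \<noteq> 0" using that by (simp add: mod_eq_0_iff_dvd)
      then show ?thesis
        using pos_mod_sign[of "int N" x] pos_mod_bound[of "int N" x] N
        unfolding nonzero_residues_def atLeastLessThan_iff by linarith
    qed
    interpret modulus N by unfold_locales (rule N)
    interpret sum_free_cover N a r A
    proof unfold_locales
      show "0 < r" using False by simp
      show "periodic (\<lambda>x. x \<in> A i)" for i
        by (simp add: periodic_def A_def dvd_mod_iff)
      show "x + int a * y \<notin> A i" if "x \<in> A i" "y \<in> A i" for x y i
      proof
        assume "x + int a * y \<in> A i"
        moreover have "[int a * (y mod int N) + x mod int N - (x + int a * y) mod int N = 0] (mod int N)"
        proof -
          have "[z mod int N = z] (mod int N)" for z by (simp add: cong_def)
          then have "[int a * (y mod int N) + x mod int N - (x + int a * y) mod int N = int a * y + x - (x + int a * y)] (mod int N)"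
            by (intro cong_diff cong_add cong_mult cong_refl)
          then show ?thesis by simp
        qed
        \<comment> \<open>The coefficient \<open>a\<close> belongs to the first entry, so
          \<open>y\<close> plays \<open>x1\<close> and \<open>x\<close> plays
          \<open>x2\<close>.\<close>
        ultimately have "monochromatic_solution a N c (y mod int N) (x mod int N) ((x + int a * y) mod int N)"
          using that nz by (simp add: monochromatic_solution_def A_def)
        then show False using none by blast
      qed
      show "\<exists>i\<in>{1..r}. x \<in> A i" if "\<not> int N dvd x" for x
        using nz[OF that] that col by (auto simp: is_colouring_def A_def)
    qed
    have "(2 * real r) powr 148 = (2 * real r) ^ 148"
      using False by (simp add: powr_numeral)
    then show ?thesis using modulus_bound by simp
  qed
qed simp

end
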